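(* Let $n\ge 1$ and let the unknown partition of an $n$-element set $S$ be chosen uniformly at random among all set partitions of $S$. Among all active clustering (AC) algorithms on $S$, an AC algorithm has minimal average complexity (expected number of queries) if and only if it is chordal.
   Context: Setting. $S$ is a finite set of items carrying an unknown set partition $P$. An AC algorithm repeatedly asks an oracle whether two items lie in the same block of $P$; the choice of each query may depend on earlier answers. The progress is recorded by aggregated graphs: $G_0$ is the edgeless graph whose vertices are the elements of $S$ (each labelled by itself); each query concerns two distinct non-adjacent vertices $x,y$ of the current aggregated graph $G_t$ (i.e. items whose relation is not already determined by earlier answers and transitivity). If the answer is negative, $G_{t+1}$ is $G_t$ plus the edge $xy$; if positive, $G_{t+1}$ is obtained by merging $x$ and $y$ into a single vertex adjacent to all neighbours of $x$ and of $y$ and labelled by the union of their labels. The algorithm stops when the aggregated graph is complete (its vertices then correspond exactly to the blocks of $P$). The complexity on $P$ is the number of queries made; the average complexity is its expectation over the random partition. An AC algorithm is chordal if, for every input partition, every aggregated graph it produces is chordal (every induced cycle has length $3$). *)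

theory Defs
  imports "HOL-Library.Disjoint_Sets" "HOL-Probability.Probability_Mass_Function"
begin

section \<open>Graphs\<close>

text \<open>Only finite simple graphs arise; they are given by a vertex set and a set of two-element edges.\<close>

record 'v graph =
  verts :: "'v set"
  edges :: "'v set set"

definition complete_graph :: "'v graph \<Rightarrow> bool" where
  "complete_graph G \<longleftrightarrow> (\<forall>x\<in>verts G. \<forall>y\<in>verts G. x \<noteq> y \<longrightarrow> {x, y} \<in> edges G)"

definition induced_cycle :: "'v graph \<Rightarrow> 'v list \<Rightarrow> bool" where
  "induced_cycle G c \<longleftrightarrow>
     3 \<le> length c \<and> distinct c \<and> set c \<subseteq> verts G \<and>
     (\<forall>i<length c. \<forall>j<length c.
        {c ! i, c ! j} \<in> edges G \<longleftrightarrow>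
          j = Suc i mod length c \<or> i = Suc j mod length c)"

definition chordal :: "'v graph \<Rightarrow> bool" where
  "chordal G \<longleftrightarrow> (\<forall>c. induced_cycle G c \<longrightarrow> length c = 3)"

section \<open>Aggregated graphs\<close>

text \<open>
  A vertex of an aggregated graph is identified with its label, a set of items. This is
  harmless because the labels of distinct vertices stay nonempty and disjoint.
\<close>

definition initial_graph :: "'a set \<Rightarrow> 'a set graph" where
  "initial_graph S = \<lparr>verts = (\<lambda>s. {s}) ` S, edges = {}\<rparr>"

definition vertex_of :: "'a set graph \<Rightarrow> 'a \<Rightarrow> 'a set" where
  "vertex_of G a = (THE v. v \<in> verts G \<and> a \<in> v)"

definition add_edge :: "'v \<Rightarrow> 'v \<Rightarrow> 'v graph \<Rightarrow> 'v graph" where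
  "add_edge x y G = G\<lparr>edges := insert {x, y} (edges G)\<rparr>"

definition merge :: "'a set \<Rightarrow> 'a set \<Rightarrow> 'a set graph \<Rightarrow> 'a set graph" where
  "merge x y G =
     \<lparr>verts = insert (x \<union> y) (verts G - {x, y}),
      edges = {e \<in> edges G. x \<notin> e \<and> y \<notin> e} \<union>
              {{x \<union> y, z} | z. {x, z} \<in> edges G \<or> {y, z} \<in> edges G}\<rparr>"

section \<open>Active clustering algorithms\<close>

text \<open>
  A (deterministic) algorithm maps the list of queries asked so far together with their
  answers, most recent first, to the next pair of items to query.
\<close>

type_synonym 'a history = "(('a \<times> 'a) \<times> bool) list"
type_synonym 'a algorithm = "'a history \<Rightarrow> 'a \<times> 'a"

definition oracle_answer :: "'a set set \<Rightarrow> 'a \<times> 'a \<Rightarrow> bool" where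
  "oracle_answer P q \<longleftrightarrow> (\<exists>B\<in>P. fst q \<in> B \<and> snd q \<in> B)"

definition update_graph :: "'a \<times> 'a \<Rightarrow> bool \<Rightarrow> 'a set graph \<Rightarrow> 'a set graph" where
  "update_graph q ans G =
     (let x = vertex_of G (fst q); y = vertex_of G (snd q)
      in if ans then merge x y G else add_edge x y G)"

text \<open>The history and the aggregated graph after \<open>t\<close> queries; both are frozen once the
  aggregated graph is complete.\<close>

primrec run :: "'a set \<Rightarrow> 'a algorithm \<Rightarrow> 'a set set \<Rightarrow> nat \<Rightarrow> 'a history \<times> 'a set graph" where
  "run S A P 0 = ([], initial_graph S)"
| "run S A P (Suc t) =
     (let (h, G) = run S A P t
      in if complete_graph G then (h, G)
         else let q = A h; ans = oracle_answer P q
              in ((q, ans) # h, update_graph q ans G))"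

definition aggregated_graph ::
    "'a set \<Rightarrow> 'a algorithm \<Rightarrow> 'a set set \<Rightarrow> nat \<Rightarrow> 'a set graph" where
  "aggregated_graph S A P t = snd (run S A P t)"

definition next_query :: "'a set \<Rightarrow> 'a algorithm \<Rightarrow> 'a set set \<Rightarrow> nat \<Rightarrow> 'a \<times> 'a" where
  "next_query S A P t = A (fst (run S A P t))"

definition admissible_query :: "'a set \<Rightarrow> 'a set graph \<Rightarrow> 'a \<times> 'a \<Rightarrow> bool" where
  "admissible_query S G q \<longleftrightarrow>
     fst q \<in> S \<and> snd q \<in> S \<and>
     vertex_of G (fst q) \<noteq> vertex_of G (snd q) \<and>
     {vertex_of G (fst q), vertex_of G (snd q)} \<notin> edges G"

definition AC_algorithm :: "'a set \<Rightarrow> 'a algorithm \<Rightarrow> bool" where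
  "AC_algorithm S A \<longleftrightarrow>
     (\<forall>P t. partition_on S P \<longrightarrow> \<not> complete_graph (aggregated_graph S A P t) \<longrightarrow>
        admissible_query S (aggregated_graph S A P t) (next_query S A P t))"

text \<open>
  The minimum exists for every AC algorithm on a finite set, since each admissible query
  strictly decreases the number of pairs of distinct non-adjacent vertices.
\<close>

definition complexity :: "'a set \<Rightarrow> 'a algorithm \<Rightarrow> 'a set set \<Rightarrow> nat" where
  "complexity S A P = (LEAST t. complete_graph (aggregated_graph S A P t))"

definition average_complexity :: "'a set \<Rightarrow> 'a algorithm \<Rightarrow> real" where
  "average_complexity S A =
     measure_pmf.expectation (pmf_of_set {P. partition_on S P}) (\<lambda>P. real (complexity S A P))"

definition minimal_average_complexity :: "'a set \<Rightarrow> 'a algorithm \<Rightarrow> bool" where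
  "minimal_average_complexity S A \<longleftrightarrow>
     (\<forall>B. AC_algorithm S B \<longrightarrow> average_complexity S A \<le> average_complexity S B)"

definition chordal_algorithm :: "'a set \<Rightarrow> 'a algorithm \<Rightarrow> bool" where
  "chordal_algorithm S A \<longleftrightarrow>
     (\<forall>P t. partition_on S P \<longrightarrow> chordal (aggregated_graph S A P t))"

end

theory Submission imports Defs begin

text \<open>
  Call a negative query between items of the blocks \<open>B\<close> and \<open>B'\<close> forced if these items are already
  linked by earlier queries inside \<open>B \<union> B'\<close>. For every union \<open>U\<close> of at most two blocks, exactly
  \<open>card U - 1\<close> queries inside \<open>U\<close> join two different classes of linked items. Exchanging the two
  blocks on one of these classes does not change the earlier answers but reverses the answer to such
  a query, so over all partitions half of these answers are negative. Hence the total number of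
  queries is a constant depending only on \<open>S\<close> plus the number of forced queries. Inserting items one by one into
  a clique never forces a query, so the minimal algorithms are those without forced queries.

  A forced query closes a path of odd length inside the bipartite graph on \<open>B \<union> B'\<close>, and a shortest
  such path becomes an induced cycle. Conversely, the first non-chordal graph arises from a query that
  joins the ends of an induced path with at least four vertices. If their number is even, then an
  alternating colouring makes the query forced; if it is odd, then a negative answer yields an odd
  induced cycle, and the first chord queried there splits off an even cycle.
\<close>

text \<open>Exchanging sides can fuse two blocks into one or split one block into two, so the
  halving argument cannot be carried out on the pairs of blocks of a fixed partition. It is done,
  for each time separately, on all partitions with a marked ordered pair (\<open>C\<close>,
  \<open>D\<close>), where one of the two sets may be empty; a single block occurs with both
  placements. The events on this family are closed under the exchange, and the order of the pair
  yields four equally large cases for the sides of the two queried items. This is the origin of the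
  factor 4 in the counting identity. A query that destroys chordality in the run on one partition
  need not be forced in that run. The forced query is sought in the run on another partition that
  gives the same earlier answers. It counts because every partition has positive weight in the
  uniform average.\<close>

section \<open>Set partitions and merging two blocks\<close>

lemma partition_on_unique:
  assumes "partition_on S P" "B \<in> P" "B' \<in> P" "a \<in> B" "a \<in> B'"
  shows "B = B'"
  using partition_onD2[OF assms(1)] assms(2-) by (auto simp: disjoint_def)

lemma partition_on_obtain:
  assumes "partition_on S P" "a \<in> S"
  obtains B where "B \<in> P" "a \<in> B"
  using assms partition_onD1 by blast

lemma partition_on_subset: "partition_on S P \<Longrightarrow> B \<in> P \<Longrightarrow> B \<subseteq> S"
  using partition_onD1 by blast

lemma partition_on_merge:
  assumes "partition_on U C" "X \<in> C" "Y \<in> C"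
  shows "partition_on U (insert (X \<union> Y) (C - {X, Y}))"
proof (rule partition_onI)
  show "\<Union>(insert (X \<union> Y) (C - {X, Y})) = U"
    using partition_onD1[OF assms(1)] assms(2,3) by auto
  have d: "p \<inter> q = {}" if "p \<in> C" "q \<in> C" "p \<noteq> q" for p q
    using that partition_onD2[OF assms(1)] by (auto simp: disjoint_def)
  have e: "(X \<union> Y) \<inter> q = {}" if "q \<in> C - {X, Y}" for q
    using that d[of X q] d[of Y q] assms(2,3) by (auto simp: Int_Un_distrib2)
  show "disjnt p q" if "p \<in> insert (X \<union> Y) (C - {X, Y})" "q \<in> insert (X \<union> Y) (C - {X, Y})" "p \<noteq> q" for p q
  proof -
    consider "p = X \<union> Y" "q \<in> C - {X, Y}" | "q = X \<union> Y" "p \<in> C - {X, Y}" | "p \<in> C" "q \<in> C"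
      using \<open>p \<in> _\<close> \<open>q \<in> _\<close> \<open>p \<noteq> q\<close> by blast
    then show ?thesis
      unfolding disjnt_def using e[of p] e[of q] d[of p q] \<open>p \<noteq> q\<close>
      by cases (simp_all add: Int_commute)
  qed
  show "{} \<notin> insert (X \<union> Y) (C - {X, Y})"
    using partition_onD3[OF assms(1)] assms(2,3) by auto
qed

lemma card_merge:
  assumes "partition_on U C" "finite C" "X \<in> C" "Y \<in> C" "X \<noteq> Y"
  shows "Suc (card (insert (X \<union> Y) (C - {X, Y}))) = card C"
proof -
  have "X \<union> Y \<notin> C - {X, Y}"
  proof
    assume *: "X \<union> Y \<in> C - {X, Y}"
    obtain a where "a \<in> X" using partition_onD3[OF assms(1)] assms(3) by fastforce
    then show False using partition_on_unique[OF assms(1), of "X \<union> Y" X a] * assms(3) by blast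
  qed
  then have "card (insert (X \<union> Y) (C - {X, Y})) = Suc (card (C - {X, Y}))"
    using assms(2) by simp
  also have "card (C - {X, Y}) = card C - 2"
    using assms by (subst card_Diff_subset) auto
  finally show ?thesis
    using card_mono[of C "{X, Y}"] assms by simp
qed

section \<open>Classes of items linked by queries\<close>

text \<open>Phrased with items instead of classes, so that it is total; if both items already share
  a class of the partition \<open>C\<close>, nothing changes.\<close>

definition join :: "'a \<Rightarrow> 'a \<Rightarrow> 'a set set \<Rightarrow> 'a set set" where
  "join a b C = insert (\<Union>{K \<in> C. a \<in> K \<or> b \<in> K}) {K \<in> C. a \<notin> K \<and> b \<notin> K}"

text \<open>These are the connected components of the graph on \<open>U\<close> formed by the
  queried pairs inside \<open>U\<close>, whatever their answers. They are kept as a partition rather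
  than as a reachability relation so that they can be counted.\<close>

primrec link_classes :: "'a history \<Rightarrow> 'a set \<Rightarrow> 'a set set" where
  "link_classes [] U = (\<lambda>u. {u}) ` U"
| "link_classes (e # h) U =
     (if fst (fst e) \<in> U \<and> snd (fst e) \<in> U
      then join (fst (fst e)) (snd (fst e)) (link_classes h U) else link_classes h U)"

definition linked :: "'a history \<Rightarrow> 'a set \<Rightarrow> 'a \<Rightarrow> 'a \<Rightarrow> bool" where
  "linked h U a b \<longleftrightarrow> (\<exists>K\<in>link_classes h U. a \<in> K \<and> b \<in> K)"

lemma join_eq:
  assumes "partition_on U C" "X \<in> C" "a \<in> X" "Y \<in> C" "b \<in> Y"
  shows "join a b C = insert (X \<union> Y) (C - {X, Y})"
proof -
  have "K = X" if "K \<in> C" "a \<in> K" for K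
    using partition_on_unique[OF assms(1) that(1) assms(2) that(2) assms(3)] .
  moreover have "K = Y" if "K \<in> C" "b \<in> K" for K
    using partition_on_unique[OF assms(1) that(1) assms(4) that(2) assms(5)] .
  ultimately have "{K \<in> C. a \<in> K \<or> b \<in> K} = {X, Y}" "{K \<in> C. a \<notin> K \<and> b \<notin> K} = C - {X, Y}"
    using assms by blast+
  then show ?thesis by (simp add: join_def)
qed

lemma partition_on_link_classes: "partition_on U (link_classes h U)"
proof (induction h)
  case Nil
  then show ?case by (simp add: partition_on_singletons)
next
  case (Cons e h)
  show ?case
  proof (cases "fst (fst e) \<in> U \<and> snd (fst e) \<in> U")
    case True
    obtain X Y where "X \<in> link_classes h U" "fst (fst e) \<in> X" "Y \<in> link_classes h U" "snd (fst e) \<in> Y"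
      using partition_on_obtain[OF Cons] True by metis
    then show ?thesis
      using True partition_on_merge[OF Cons, of X Y] by (simp add: join_eq[OF Cons, of X _ Y])
  qed (use Cons in auto)
qed

lemma finite_link_classes: "finite U \<Longrightarrow> finite (link_classes h U)"
  using finite_elements partition_on_link_classes by blast

lemma linked_refl: "a \<in> U \<Longrightarrow> linked h U a a"
  unfolding linked_def using partition_on_obtain[OF partition_on_link_classes] by metis

lemma linked_sym: "linked h U a b \<Longrightarrow> linked h U b a"
  unfolding linked_def by blast

lemma linked_trans: "linked h U a b \<Longrightarrow> linked h U b c \<Longrightarrow> linked h U a c"
  unfolding linked_def using partition_on_unique[OF partition_on_link_classes, of _ h U _ b] by blast

lemma linked_Cons:
  assumes "linked h U a b" shows "linked (e # h) U a b"
proof -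
  obtain K where K: "K \<in> link_classes h U" "a \<in> K" "b \<in> K"
    using assms by (auto simp: linked_def)
  then show ?thesis
    by (auto simp: linked_def join_def)
qed

lemma linked_Cons_self:
  assumes "a \<in> U" "b \<in> U" shows "linked (((a, b), r) # h) U a b"
proof -
  obtain X Y where "X \<in> link_classes h U" "a \<in> X" "Y \<in> link_classes h U" "b \<in> Y"
    using partition_on_obtain[OF partition_on_link_classes] assms by metis
  then show ?thesis
    using assms by (auto simp: linked_def join_def)
qed

text \<open>A query inside \<open>U\<close> either stays within one class or fuses two of them. The
  additive form with \<open>of_bool\<close> telescopes along a run.\<close>

lemma card_link_classes_Cons:
  assumes "finite U"
  shows "card (link_classes (((a, b), r) # h) U) + of_bool (a \<in> U \<and> b \<in> U \<and> \<not> linked h U a b)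
    = card (link_classes h U)"
proof (cases "a \<in> U \<and> b \<in> U")
  case True
  obtain X Y where XY: "X \<in> link_classes h U" "a \<in> X" "Y \<in> link_classes h U" "b \<in> Y"
    using partition_on_obtain[OF partition_on_link_classes] True by metis
  note j = join_eq[OF partition_on_link_classes this]
  show ?thesis
  proof (cases "X = Y")
    case True
    then have "linked h U a b" using XY by (auto simp: linked_def)
    then show ?thesis using True j XY by (simp add: insert_absorb)
  next
    case False
    then have "\<not> linked h U a b"
      using XY partition_on_unique[OF partition_on_link_classes] unfolding linked_def by metis
    then show ?thesis
      using True j card_merge[OF partition_on_link_classes finite_link_classes[OF assms] XY(1,3) False] by simp
  qed
qed auto

text \<open>If no query inside \<open>U\<close> crosses the border of \<open>X\<close>, then joining
  never mixes items inside and outside \<open>X\<close>. With a set of reachable items as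
  \<open>X\<close>, this turns being linked into reachability in the graph.\<close>

lemma linked_closed:
  assumes "\<And>a b r. ((a, b), r) \<in> set h \<Longrightarrow> a \<in> U \<Longrightarrow> b \<in> U \<Longrightarrow> a \<in> X \<longleftrightarrow> b \<in> X"
    and "linked h U a b"
  shows "a \<in> X \<longleftrightarrow> b \<in> X"
proof -
  have "\<forall>K\<in>link_classes h U. K \<subseteq> X \<or> K \<inter> X = {}"
    using assms(1)
  proof (induction h)
    case (Cons e h)
    have IH: "\<forall>K\<in>link_classes h U. K \<subseteq> X \<or> K \<inter> X = {}"
      using Cons.IH Cons.prems by fastforce
    obtain x y r where e: "e = ((x, y), r)" by (metis prod.exhaust)
    show ?case
    proof (cases "x \<in> U \<and> y \<in> U")
      case True
      then have "x \<in> X \<longleftrightarrow> y \<in> X" using Cons.prems[of x y r] e by simp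
      then have "K \<subseteq> X \<or> K \<inter> X = {}" if "K \<in> join x y (link_classes h U)" for K
        using that IH unfolding join_def by (cases "y \<in> X") blast+
      then show ?thesis using True e by simp
    qed (use IH e in auto)
  qed auto
  then show ?thesis using assms(2) unfolding linked_def by blast
qed


lemma linked_query:
  assumes "((a, b), r) \<in> set h" "a \<in> U" "b \<in> U"
  shows "linked h U a b"
  using assms(1)
proof (induction h)
  case (Cons e h)
  then show ?case using linked_Cons_self[OF assms(2,3)] linked_Cons[of h U a b e] by auto
qed auto

section \<open>Invariants of aggregated graphs\<close>

definition wf_graph :: "'a set \<Rightarrow> 'a set graph \<Rightarrow> bool" where
  "wf_graph S G \<longleftrightarrow> partition_on S (verts G) \<and>
     (\<forall>e\<in>edges G. \<exists>v\<in>verts G. \<exists>w\<in>verts G. v \<noteq> w \<and> e = {v, w})"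

text \<open>For a graph met in a run, the partitions of \<open>S\<close> satisfying this are exactly
  those that would have given the same answers so far.\<close>

definition consistent :: "'a set set \<Rightarrow> 'a set graph \<Rightarrow> bool" where
  "consistent P G \<longleftrightarrow> (\<forall>v\<in>verts G. \<exists>B\<in>P. v \<subseteq> B) \<and>
     (\<forall>v w B. {v, w} \<in> edges G \<longrightarrow> B \<in> P \<longrightarrow> \<not> (v \<subseteq> B \<and> w \<subseteq> B))"

definition recorded :: "'a set \<Rightarrow> 'a history \<Rightarrow> 'a set graph \<Rightarrow> bool" where
  "recorded S h G \<longleftrightarrow> (\<forall>a b r. ((a, b), r) \<in> set h \<longrightarrow> a \<in> S \<and> b \<in> S \<and>
     (if r then vertex_of G a = vertex_of G b else {vertex_of G a, vertex_of G b} \<in> edges G))"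

lemma recorded_Cons:
  "recorded S ((q, r) # h) G \<longleftrightarrow> recorded S h G \<and> fst q \<in> S \<and> snd q \<in> S \<and>
     (if r then vertex_of G (fst q) = vertex_of G (snd q)
      else {vertex_of G (fst q), vertex_of G (snd q)} \<in> edges G)"
  by (cases q) (simp only: recorded_def list.set insert_iff prod.inject fst_conv snd_conv, blast)

lemma wf_graph_partition: "wf_graph S G \<Longrightarrow> partition_on S (verts G)"
  by (simp add: wf_graph_def)

lemma wf_graph_edge:
  assumes "wf_graph S G" "{v, w} \<in> edges G"
  shows "v \<in> verts G" "w \<in> verts G" "v \<noteq> w"
proof -
  obtain v' w' where "v' \<in> verts G" "w' \<in> verts G" "v' \<noteq> w'" "{v, w} = {v', w'}"
    using assms unfolding wf_graph_def by metis
  then show "v \<in> verts G" "w \<in> verts G" "v \<noteq> w" by (auto simp: doubleton_eq_iff)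
qed

lemma vertex_of_eq:
  assumes "wf_graph S G" "v \<in> verts G" "a \<in> v"
  shows "vertex_of G a = v"
  unfolding vertex_of_def
  using assms partition_on_unique[OF wf_graph_partition[OF assms(1)]] by (intro the_equality) blast+

lemma vertex_of_mem:
  assumes "wf_graph S G" "a \<in> S"
  shows "vertex_of G a \<in> verts G" "a \<in> vertex_of G a"
proof -
  obtain v where "v \<in> verts G" "a \<in> v"
    using partition_on_obtain[OF wf_graph_partition[OF assms(1)] assms(2)] .
  then show "vertex_of G a \<in> verts G" "a \<in> vertex_of G a"
    using vertex_of_eq[OF assms(1)] by auto
qed

lemma vert_nonempty: "wf_graph S G \<Longrightarrow> v \<in> verts G \<Longrightarrow> v \<noteq> {}"
  using wf_graph_partition partition_onD3 by blast

lemma vert_subset: "wf_graph S G \<Longrightarrow> v \<in> verts G \<Longrightarrow> v \<subseteq> S"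
  using wf_graph_partition partition_on_subset by blast

lemma vert_eq_if_subset:
  assumes "wf_graph S G" "v \<in> verts G" "w \<in> verts G" "v \<subseteq> w"
  shows "v = w"
  using assms vert_nonempty[OF assms(1,2)] partition_on_unique[OF wf_graph_partition[OF assms(1)]]
  by blast

text \<open>A vertex \<open>x \<union> y\<close> would contain the vertices \<open>x\<close> and
  \<open>y\<close> and hence equal both. So the merged label is fresh, and edges at it arise only
  from the merge itself.\<close>

lemma union_notin_verts:
  assumes "wf_graph S G" "x \<in> verts G" "y \<in> verts G" "x \<noteq> y"
  shows "x \<union> y \<notin> verts G"
  using vert_eq_if_subset[OF assms(1), of x "x \<union> y"] vert_eq_if_subset[OF assms(1), of y "x \<union> y"] assms
  by auto

lemma wf_initial_graph: "wf_graph S (initial_graph S)"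
  by (simp add: wf_graph_def initial_graph_def partition_on_singletons)

lemma verts_add_edge [simp]: "verts (add_edge x y G) = verts G"
  and edges_add_edge [simp]: "edges (add_edge x y G) = insert {x, y} (edges G)"
  by (simp_all add: add_edge_def)

lemma vertex_of_add_edge [simp]: "vertex_of (add_edge x y G) a = vertex_of G a"
  by (simp add: vertex_of_def)

lemma verts_merge: "verts (merge x y G) = insert (x \<union> y) (verts G - {x, y})"
  by (simp add: merge_def)

lemma wf_add_edge:
  assumes "wf_graph S G" "x \<in> verts G" "y \<in> verts G" "x \<noteq> y"
  shows "wf_graph S (add_edge x y G)"
  using assms unfolding wf_graph_def by auto

context
  fixes S :: "'a set" and G :: "'a set graph" and x y :: "'a set"
  assumes wf: "wf_graph S G" and x: "x \<in> verts G" and y: "y \<in> verts G"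
    and ne: "x \<noteq> y" and nadj: "{x, y} \<notin> edges G"
begin

lemma edges_merge_old:
  assumes "v \<in> verts G" "w \<in> verts G" "v \<notin> {x, y}" "w \<notin> {x, y}"
  shows "{v, w} \<in> edges (merge x y G) \<longleftrightarrow> {v, w} \<in> edges G"
proof -
  have "v \<noteq> x \<union> y" "w \<noteq> x \<union> y" using union_notin_verts[OF wf x y ne] assms by auto
  then show ?thesis using assms unfolding merge_def by (auto simp: doubleton_eq_iff)
qed

lemma edges_merge_new:
  assumes "w \<in> verts G"
  shows "{x \<union> y, w} \<in> edges (merge x y G) \<longleftrightarrow> {x, w} \<in> edges G \<or> {y, w} \<in> edges G"
proof -
  have *: "x \<union> y \<noteq> w" using union_notin_verts[OF wf x y ne] assms by auto
  have "{x \<union> y, w} \<notin> edges G"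
    using wf_graph_edge(1)[OF wf] union_notin_verts[OF wf x y ne] by blast
  then show ?thesis using * unfolding merge_def by (auto simp: doubleton_eq_iff)
qed

text \<open>The other end of a new edge is never one of the two vanished vertices: this would
  require a loop or an edge between \<open>x\<close> and \<open>y\<close>.\<close>

lemma edges_mergeE:
  assumes "e \<in> edges (merge x y G)"
  obtains (old) v w where "e = {v, w}" "v \<in> verts G" "w \<in> verts G" "v \<notin> {x, y}" "w \<notin> {x, y}"
      "{v, w} \<in> edges G" "v \<noteq> w"
    | (new) w where "e = {x \<union> y, w}" "w \<in> verts G" "w \<notin> {x, y}" "{x, w} \<in> edges G \<or> {y, w} \<in> edges G"
proof -
  consider "e \<in> edges G" "x \<notin> e" "y \<notin> e"
    | w where "e = {x \<union> y, w}" "{x, w} \<in> edges G \<or> {y, w} \<in> edges G"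
    using assms unfolding merge_def by auto
  then show ?thesis
  proof cases
    case 1
    then obtain v w where "v \<in> verts G" "w \<in> verts G" "v \<noteq> w" "e = {v, w}"
      using wf unfolding wf_graph_def by metis
    then show ?thesis using 1 old by auto
  next
    case (2 w)
    have "w \<in> verts G" "w \<notin> {x, y}"
      using 2(2) wf_graph_edge[OF wf] nadj by (auto simp: insert_commute)
    then show ?thesis using 2 new by auto
  qed
qed

lemma wf_merge: "wf_graph S (merge x y G)"
  unfolding wf_graph_def
proof (intro conjI ballI)
  show "partition_on S (verts (merge x y G))"
    unfolding verts_merge using partition_on_merge[OF wf_graph_partition[OF wf] x y] .
  fix e assume "e \<in> edges (merge x y G)"
  then show "\<exists>v\<in>verts (merge x y G). \<exists>w\<in>verts (merge x y G). v \<noteq> w \<and> e = {v, w}"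
  proof (cases rule: edges_mergeE)
    case (old v w)
    then have "v \<in> verts (merge x y G)" "w \<in> verts (merge x y G)" by (auto simp: verts_merge)
    then show ?thesis using old(1,7) by metis
  next
    case (new w)
    then have "w \<noteq> x \<union> y" using union_notin_verts[OF wf x y ne] by auto
    moreover have "w \<in> verts (merge x y G)" "x \<union> y \<in> verts (merge x y G)"
      using new by (auto simp: verts_merge)
    ultimately show ?thesis using new(1) by metis
  qed
qed

lemma vertex_of_merge:
  assumes "a \<in> S"
  shows "vertex_of (merge x y G) a = (if vertex_of G a \<in> {x, y} then x \<union> y else vertex_of G a)"
  using vertex_of_mem[OF wf assms] by (intro vertex_of_eq[OF wf_merge]) (auto simp: verts_merge)

lemma recorded_merge:
  assumes "recorded S h G"
  shows "recorded S h (merge x y G)"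
  unfolding recorded_def
proof (intro allI impI)
  fix a b r assume "((a, b), r) \<in> set h"
  then have *: "a \<in> S" "b \<in> S"
      "if r then vertex_of G a = vertex_of G b else {vertex_of G a, vertex_of G b} \<in> edges G"
    using assms unfolding recorded_def by blast+
  have "{vertex_of (merge x y G) a, vertex_of (merge x y G) b} \<in> edges (merge x y G)"
    if e: "{vertex_of G a, vertex_of G b} \<in> edges G"
  proof -
    have m: "vertex_of G a \<in> verts G" "vertex_of G b \<in> verts G"
      using vertex_of_mem[OF wf] * by auto
    have "\<not> (vertex_of G a \<in> {x, y} \<and> vertex_of G b \<in> {x, y})"
      using wf_graph_edge(3)[OF wf e] e nadj by (auto simp: insert_commute)
    then consider "vertex_of G a \<in> {x, y}" "vertex_of G b \<notin> {x, y}"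
      | "vertex_of G a \<notin> {x, y}" "vertex_of G b \<in> {x, y}"
      | "vertex_of G a \<notin> {x, y}" "vertex_of G b \<notin> {x, y}" by blast
    then show ?thesis
    proof cases
      case 1
      then show ?thesis using edges_merge_new[OF m(2)] e *(1,2) by (auto simp: vertex_of_merge)
    next
      case 2
      then show ?thesis using edges_merge_new[OF m(1)] e *(1,2)
        by (auto simp: vertex_of_merge insert_commute)
    next
      case 3
      then show ?thesis using edges_merge_old[OF m] e *(1,2) by (auto simp: vertex_of_merge)
    qed
  qed
  then show "a \<in> S \<and> b \<in> S \<and> (if r then vertex_of (merge x y G) a = vertex_of (merge x y G) b
      else {vertex_of (merge x y G) a, vertex_of (merge x y G) b} \<in> edges (merge x y G))"
    using * by (auto simp: vertex_of_merge split: if_splits)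
qed

lemma consistent_merge:
  assumes "partition_on S P" "consistent P G" "B \<in> P" "x \<subseteq> B" "y \<subseteq> B"
  shows "consistent P (merge x y G)"
  unfolding consistent_def
proof (intro conjI ballI allI impI)
  fix v assume "v \<in> verts (merge x y G)"
  then show "\<exists>B\<in>P. v \<subseteq> B"
    using assms unfolding verts_merge consistent_def by blast
next
  fix v w B' assume e: "{v, w} \<in> edges (merge x y G)" and B': "B' \<in> P"
  have c: "\<not> (v \<subseteq> B' \<and> w \<subseteq> B')" if "{v, w} \<in> edges G" for v w
    using assms(2) that B' unfolding consistent_def by blast
  have c': "\<not> (x \<union> y \<subseteq> B' \<and> w \<subseteq> B')" if "{x, w} \<in> edges G \<or> {y, w} \<in> edges G" for w
    using c that by blast
  show "\<not> (v \<subseteq> B' \<and> w \<subseteq> B')"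
    using e
  proof (cases rule: edges_mergeE)
    case (old v' w')
    then show ?thesis using c[of v' w'] by (auto simp: doubleton_eq_iff)
  next
    case (new w')
    then show ?thesis using c'[of w'] by (auto simp: doubleton_eq_iff)
  qed
qed

lemma card_verts_merge:
  assumes "finite S"
  shows "Suc (card (verts (merge x y G))) = card (verts G)"
  unfolding verts_merge
  using card_merge[OF wf_graph_partition[OF wf] finite_elements[OF assms wf_graph_partition[OF wf]] x y ne] .

end

section \<open>Partitions consistent with the recorded answers\<close>

lemma oracle_answer_iff:
  assumes "partition_on S P" "B \<in> P" "a \<in> B"
  shows "oracle_answer P (a, b) \<longleftrightarrow> b \<in> B"
  using assms partition_on_unique[OF assms(1)] unfolding oracle_answer_def by auto

lemma consistent_block:
  assumes "partition_on S P" "consistent P G" "v \<in> verts G" "B \<in> P" "a \<in> v" "a \<in> B"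
  shows "v \<subseteq> B"
  using assms partition_on_unique[OF assms(1)] unfolding consistent_def by blast

text \<open>A positive answer is recorded inside one vertex, hence inside one block; a negative one
  by two adjacent vertices, which no block contains together.\<close>

lemma consistent_agrees:
  assumes "wf_graph S G" "recorded S h G" "partition_on S P" "consistent P G" "((a, b), r) \<in> set h"
  shows "oracle_answer P (a, b) = r"
proof -
  have *: "a \<in> S" "b \<in> S"
      "if r then vertex_of G a = vertex_of G b else {vertex_of G a, vertex_of G b} \<in> edges G"
    using assms(2,5) unfolding recorded_def by blast+
  note m = vertex_of_mem[OF assms(1) *(1)] vertex_of_mem[OF assms(1) *(2)]
  obtain B where B: "B \<in> P" "a \<in> B" using partition_on_obtain[OF assms(3) *(1)] .
  have va: "vertex_of G a \<subseteq> B" using consistent_block[OF assms(3,4) m(1) B(1) m(2) B(2)] .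
  have "vertex_of G b \<subseteq> B" if "b \<in> B"
    using consistent_block[OF assms(3,4) m(3) B(1) m(4) that] .
  then have "b \<in> B \<longleftrightarrow> r"
    using * va m(4) assms(4) B(1) unfolding consistent_def by (auto split: if_splits)
  then show ?thesis using oracle_answer_iff[OF assms(3) B] by simp
qed

lemma update_graph_cases:
  "update_graph q r G = (if r then merge (vertex_of G (fst q)) (vertex_of G (snd q)) G
     else add_edge (vertex_of G (fst q)) (vertex_of G (snd q)) G)"
  by (simp add: update_graph_def Let_def)

lemma admissible_queryD:
  assumes "wf_graph S G" "admissible_query S G q"
  shows "fst q \<in> S" "snd q \<in> S"
    "vertex_of G (fst q) \<in> verts G" "vertex_of G (snd q) \<in> verts G"
    "vertex_of G (fst q) \<noteq> vertex_of G (snd q)"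
    "{vertex_of G (fst q), vertex_of G (snd q)} \<notin> edges G"
  using assms vertex_of_mem[OF assms(1)] unfolding admissible_query_def by auto

lemma wf_update:
  assumes "wf_graph S G" "admissible_query S G q"
  shows "wf_graph S (update_graph q r G)"
  by (simp add: update_graph_cases wf_merge[OF assms(1)] wf_add_edge[OF assms(1)]
      admissible_queryD[OF assms])

lemma recorded_update:
  assumes "wf_graph S G" "admissible_query S G q" "recorded S h G"
  shows "recorded S ((q, r) # h) (update_graph q r G)"
proof -
  note adm = admissible_queryD[OF assms(1,2)]
  have "recorded S h (update_graph q r G)"
    using recorded_merge[OF assms(1) adm(3-6) assms(3)] assms(3)
    unfolding update_graph_cases by (auto simp: recorded_def)
  moreover have "if r then vertex_of (update_graph q r G) (fst q) = vertex_of (update_graph q r G) (snd q)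
      else {vertex_of (update_graph q r G) (fst q), vertex_of (update_graph q r G) (snd q)} \<in> edges (update_graph q r G)"
    using vertex_of_merge[OF assms(1) adm(3-6)] adm(1,2) unfolding update_graph_cases by auto
  ultimately show ?thesis
    using adm(1,2) by (simp add: recorded_Cons)
qed

lemma consistent_update:
  assumes "wf_graph S G" "admissible_query S G q" "partition_on S P" "consistent P G"
  shows "consistent P (update_graph q (oracle_answer P q) G)"
proof -
  note adm = admissible_queryD[OF assms(1,2)]
  note m = vertex_of_mem(2)[OF assms(1) adm(1)] vertex_of_mem(2)[OF assms(1) adm(2)]
  obtain B where B: "B \<in> P" "fst q \<in> B" using partition_on_obtain[OF assms(3) adm(1)] .
  have ans: "oracle_answer P q \<longleftrightarrow> snd q \<in> B"
    using oracle_answer_iff[OF assms(3) B, of "snd q"] by simp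
  have fB: "vertex_of G (fst q) \<subseteq> B" using consistent_block[OF assms(3,4) adm(3) B(1) m(1) B(2)] .
  show ?thesis
  proof (cases "snd q \<in> B")
    case True
    then have "vertex_of G (snd q) \<subseteq> B" using consistent_block[OF assms(3,4) adm(4) B(1) m(2)] by simp
    then show ?thesis
      using consistent_merge[OF assms(1) adm(3-6) assms(3,4) B(1) fB] ans True
      unfolding update_graph_cases by simp
  next
    case False
    have "\<not> (vertex_of G (fst q) \<subseteq> B' \<and> vertex_of G (snd q) \<subseteq> B')" if "B' \<in> P" for B'
      using that False partition_on_unique[OF assms(3) that B(1) _ B(2)] m by blast
    then show ?thesis
      using ans False assms(4) unfolding update_graph_cases consistent_def
      by (auto simp: doubleton_eq_iff)
  qed
qed

section \<open>Runs of a fixed algorithm\<close>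

locale active_clustering =
  fixes S :: "'a set" and A :: "'a algorithm"
  assumes finite_S: "finite S" and AC: "AC_algorithm S A"
begin

abbreviation "hist P t \<equiv> fst (run S A P t)"
abbreviation "graph P t \<equiv> aggregated_graph S A P t"
abbreviation "query P t \<equiv> next_query S A P t"
abbreviation "answer P t \<equiv> oracle_answer P (query P t)"
abbreviation "active P t \<equiv> \<not> complete_graph (graph P t)"

lemma hist_Suc: "hist P (Suc t) = (if active P t then (query P t, answer P t) # hist P t else hist P t)"
  by (simp add: aggregated_graph_def next_query_def Let_def case_prod_unfold)

lemma graph_0: "graph P 0 = initial_graph S"
  by (simp add: aggregated_graph_def)

lemma graph_Suc:
  "graph P (Suc t) = (if active P t then update_graph (query P t) (answer P t) (graph P t) else graph P t)"
  by (simp add: aggregated_graph_def next_query_def Let_def case_prod_unfold)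

lemma admissible: "partition_on S P \<Longrightarrow> active P t \<Longrightarrow> admissible_query S (graph P t) (query P t)"
  using AC unfolding AC_algorithm_def by blast

lemma wf_graph: "partition_on S P \<Longrightarrow> wf_graph S (graph P t)"
  by (induction t) (auto simp: graph_0 graph_Suc wf_initial_graph wf_update admissible)

lemma consistent_graph: "partition_on S P \<Longrightarrow> consistent P (graph P t)"
proof (induction t)
  case 0
  have "\<exists>B\<in>P. a \<in> B" if "a \<in> S" for a using partition_on_obtain[OF 0 that] by blast
  then show ?case by (auto simp: graph_0 initial_graph_def consistent_def)
next
  case (Suc t)
  then show ?case
    using consistent_update[OF wf_graph[OF Suc(2)] admissible[OF Suc(2)] Suc(2)] by (simp add: graph_Suc)
qed

lemma recorded_graph: "partition_on S P \<Longrightarrow> recorded S (hist P t) (graph P t)"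
proof (induction t)
  case (Suc t)
  then show ?case
    using recorded_update[OF wf_graph[OF Suc(2)] admissible[OF Suc(2)]] unfolding hist_Suc graph_Suc
    by auto
qed (simp add: recorded_def)

lemma hist_answer: "(q, r) \<in> set (hist P t) \<Longrightarrow> oracle_answer P q = r"
  by (induction t) (auto simp: hist_Suc simp del: run.simps(2) split: if_splits)

text \<open>The history alone determines the next query, so equal answers keep the runs equal. Every
  later change of the partition behind a given run rests on this.\<close>

lemma run_agree:
  assumes "\<And>q r. (q, r) \<in> set (hist P t) \<Longrightarrow> oracle_answer P' q = r"
  shows "run S A P' t = run S A P t"
  using assms
proof (induction t)
  case (Suc t)
  have eq: "run S A P' t = run S A P t"
    using Suc.IH Suc.prems unfolding hist_Suc by (auto split: if_splits)
  show ?case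
  proof (cases "active P t")
    case True
    then have "oracle_answer P' (query P t) = oracle_answer P (query P t)"
      using Suc.prems[of "query P t"] unfolding hist_Suc by simp
    then show ?thesis
      using eq by (simp add: next_query_def Let_def case_prod_unfold)
  qed (use eq in \<open>simp add: aggregated_graph_def Let_def case_prod_unfold\<close>)
qed simp

lemma run_consistent:
  assumes "partition_on S P" "partition_on S P'" "consistent P' (graph P t)"
  shows "run S A P' t = run S A P t"
  using consistent_agrees[OF wf_graph[OF assms(1)] recorded_graph[OF assms(1)] assms(2,3)]
  by (intro run_agree) auto

text \<open>The items of a pair asked before lie in one vertex or in two adjacent ones, and
  admissibility excludes both.\<close>

lemma distinct_queries: "partition_on S P \<Longrightarrow> distinct (map fst (hist P t))"
proof (induction t)
  case (Suc t)
  have "query P t \<notin> fst ` set (hist P t)" if "active P t"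
  proof
    assume "query P t \<in> fst ` set (hist P t)"
    then obtain r where "((fst (query P t), snd (query P t)), r) \<in> set (hist P t)" by auto
    then show False
      using recorded_graph[OF Suc(2), of t] admissible_queryD(5,6)[OF wf_graph[OF Suc(2)] admissible[OF Suc(2) that]]
      unfolding recorded_def by (metis (full_types))
  qed
  then show ?case using Suc unfolding hist_Suc by auto
qed simp

lemma active_mono: "active P (t + k) \<Longrightarrow> active P t"
  by (induction k) (auto simp: graph_Suc split: if_splits)

lemma length_hist: "active P t \<Longrightarrow> length (hist P (Suc t)) = Suc t"
proof (induction t)
  case (Suc t)
  then show ?case using active_mono[of P t 1] by (simp add: hist_Suc del: run.simps)
qed (simp add: hist_Suc del: run.simps(2))

text \<open>The queries are distinct ordered pairs of items. The bound is crude, but it only has to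
  be a range of times common to all partitions and algorithms.\<close>

lemma complete_at:
  assumes "partition_on S P" "card S * card S \<le> t"
  shows "\<not> active P t"
proof
  assume act: "active P t"
  have "set (map fst (hist P (Suc t))) \<subseteq> S \<times> S"
    using recorded_graph[OF assms(1), of "Suc t"] unfolding recorded_def by (auto simp del: run.simps)
  then have "card (set (map fst (hist P (Suc t)))) \<le> card (S \<times> S)"
    using finite_S by (intro card_mono) auto
  moreover have "card (set (map fst (hist P (Suc t)))) = Suc t"
    using distinct_card[OF distinct_queries[OF assms(1)], of "Suc t"] length_hist[OF act] by simp
  ultimately show False using assms(2) by (simp add: card_cartesian_product)
qed

text \<open>Counting active times makes the complexity a sum of indicators over a fixed range, so
  that sums over times and over partitions can be exchanged.\<close>

lemma complexity_eq:
  assumes "partition_on S P"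
  shows "complexity S A P = card {t. t < card S * card S \<and> active P t}"
proof -
  let ?c = "complexity S A P"
  have c: "\<not> active P ?c"
    unfolding complexity_def using complete_at[OF assms order_refl]
    using LeastI[of "\<lambda>t. complete_graph (graph P t)"] by blast
  have "active P t \<longleftrightarrow> t < ?c" for t
  proof
    assume "active P t"
    show "t < ?c"
    proof (rule ccontr)
      assume "\<not> t < ?c"
      then have "active P ?c" using active_mono[of P ?c "t - ?c"] \<open>active P t\<close> by simp
      then show False using c by simp
    qed
  next
    assume "t < ?c"
    then show "active P t" unfolding complexity_def using not_less_Least by blast
  qed
  moreover have "active P t \<Longrightarrow> t < card S * card S" for t
    using complete_at[OF assms, of t] by linarith
  ultimately have "{t. t < card S * card S \<and> active P t} = {..<?c}" by auto
  then show ?thesis by simp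
qed

end

section \<open>Counting queries\<close>

text \<open>A triple \<open>(R, C, D)\<close> encodes a partition together with an ordered choice of two of its blocks,
  or of one block and the empty set.\<close>

definition bisected_partitions :: "'a set \<Rightarrow> ('a set set \<times> 'a set \<times> 'a set) set" where
  "bisected_partitions S = {(R, C, D). C \<inter> D = {} \<and> C \<union> D \<noteq> {} \<and> C \<union> D \<subseteq> S \<and> partition_on (S - (C \<union> D)) R}"

definition glue :: "'a set set \<times> 'a set \<times> 'a set \<Rightarrow> 'a set set" where
  "glue = (\<lambda>(R, C, D). R \<union> ({C, D} - {{}}))"

lemma partition_on_glue: "z \<in> bisected_partitions S \<Longrightarrow> partition_on S (glue z)"
proof -
  assume "z \<in> bisected_partitions S"
  then obtain R C D where z: "z = (R, C, D)" and *: "C \<inter> D = {}" "C \<union> D \<subseteq> S" "partition_on (S - (C \<union> D)) R"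
    unfolding bisected_partitions_def by auto
  have R: "B \<inter> (C \<union> D) = {}" if "B \<in> R" for B using partition_on_subset[OF *(3) that] by auto
  show ?thesis
  proof (rule partition_onI)
    show "\<Union>(glue z) = S"
    proof -
      have "\<Union>({C, D} - {{}}) = C \<union> D" by blast
      then have "\<Union>(glue z) = (S - (C \<union> D)) \<union> (C \<union> D)"
        unfolding z glue_def by (simp flip: partition_onD1[OF *(3)])
      then show ?thesis using *(2) by blast
    qed
    show "{} \<notin> glue z" using partition_onD3[OF *(3)] unfolding z glue_def by auto
    have RR: "p \<inter> q = {}" if "p \<in> R" "q \<in> R" "p \<noteq> q" for p q
      using partition_onD2[OF *(3)] that by (auto simp: disjoint_def)
    show "disjnt p q" if pq: "p \<in> glue z" "q \<in> glue z" "p \<noteq> q" for p q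
    proof -
      consider "p \<in> R" "q \<in> R" | "p \<in> R" "q \<in> {C, D}" | "q \<in> R" "p \<in> {C, D}" | "{p, q} = {C, D}"
        using pq unfolding z glue_def by auto
      then show ?thesis
        unfolding disjnt_def using RR[of p q] R[of p] R[of q] pq(3) *(1)
        by cases (auto simp: doubleton_eq_iff)
    qed
  qed
qed

lemma finite_bisected_partitions:
  assumes "finite S" shows "finite (bisected_partitions S)"
proof (rule finite_subset)
  show "bisected_partitions S \<subseteq> Pow (Pow S) \<times> Pow S \<times> Pow S"
    unfolding bisected_partitions_def using partition_on_subset by fastforce
qed (use assms in simp)

lemma oracle_answer_glue:
  "oracle_answer (glue (R, C, D)) (a, b) \<longleftrightarrow>
     (\<exists>B\<in>R. a \<in> B \<and> b \<in> B) \<or> (a \<in> C \<and> b \<in> C) \<or> (a \<in> D \<and> b \<in> D)"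
  unfolding oracle_answer_def glue_def by auto

context active_clustering
begin

text \<open>The answer to a forced query would follow from the earlier ones if it were known that the items
  of the two blocks involved fall into at most two blocks.\<close>

definition forced :: "'a set set \<Rightarrow> nat \<Rightarrow> bool" where
  "forced P t \<longleftrightarrow> active P t \<and> \<not> answer P t \<and>
     (\<exists>B\<in>P. \<exists>B'\<in>P. fst (query P t) \<in> B \<and> snd (query P t) \<in> B' \<and>
        linked (hist P t) (B \<union> B') (fst (query P t)) (snd (query P t)))"

definition unforced :: "'a set set \<Rightarrow> nat \<Rightarrow> bool" where
  "unforced P t \<longleftrightarrow> active P t \<and> \<not> answer P t \<and> \<not> forced P t"

text \<open>Vertices and edges arise from queries between their items, and those lie in
  \<open>U\<close> when the labels do. Both claims go through one induction because a merge turns an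
  edge at \<open>x\<close> into one at \<open>x \<union> y\<close>, whose new items are linked to
  the neighbour through the vertices and the new query.\<close>

lemma linked_graph:
  assumes P: "partition_on S P"
  shows "(\<forall>v\<in>verts (graph P t). v \<subseteq> U \<longrightarrow> (\<forall>a\<in>v. \<forall>b\<in>v. linked (hist P t) U a b)) \<and>
    (\<forall>v w. {v, w} \<in> edges (graph P t) \<longrightarrow> v \<subseteq> U \<longrightarrow> w \<subseteq> U \<longrightarrow>
       (\<forall>a\<in>v. \<forall>b\<in>w. linked (hist P t) U a b))"
proof (induction t)
  case 0
  then show ?case by (auto simp: graph_0 initial_graph_def linked_refl)
next
  case (Suc t)
  show ?case
  proof (cases "active P t")
    case False
    then show ?thesis using Suc by (simp add: graph_Suc hist_Suc del: run.simps)
  next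
    case act: True
    define h where "h = hist P t"
    define G where "G = graph P t"
    define q where "q = query P t"
    define x where "x = vertex_of G (fst q)"
    define y where "y = vertex_of G (snd q)"
    define r where "r = answer P t"
    have wf: "wf_graph S G" and ad: "admissible_query S G q"
      using wf_graph[OF P] admissible[OF P act] by (auto simp: G_def q_def)
    note adm = admissible_queryD[OF wf ad, folded x_def y_def]
    have fx: "fst q \<in> x" "snd q \<in> y"
      using vertex_of_mem(2)[OF wf] adm by (auto simp: x_def y_def)
    note IH = Suc.IH[folded G_def h_def]
    have IHv: "linked ((q, r) # h) U a b" if "v \<in> verts G" "v \<subseteq> U" "a \<in> v" "b \<in> v" for v a b
      by (rule linked_Cons) (rule conjunct1[OF IH, rule_format, OF that])
    have IHe: "linked ((q, r) # h) U a b" if "{v, w} \<in> edges G" "v \<subseteq> U" "w \<subseteq> U" "a \<in> v" "b \<in> w" for v w a b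
      by (rule linked_Cons) (rule conjunct2[OF IH, rule_format, OF that])
    have q: "linked ((q, r) # h) U (fst q) (snd q)" if "x \<subseteq> U" "y \<subseteq> U"
      using linked_Cons_self[of "fst q" U "snd q" r h] fx that by auto
    have xy: "linked ((q, r) # h) U a (fst q)" if "x \<subseteq> U" "y \<subseteq> U" "a \<in> x \<union> y" for a
    proof (cases "a \<in> x")
      case True
      then show ?thesis using IHv[OF adm(3) that(1)] fx by blast
    next
      case False
      then have "linked ((q, r) # h) U a (snd q)" using IHv[OF adm(4) that(2)] fx that(3) by blast
      then show ?thesis using q[OF that(1,2)] linked_trans linked_sym by metis
    qed
    have hS: "hist P (Suc t) = (q, r) # h" using act by (simp add: hist_Suc q_def r_def h_def del: run.simps)
    have gS: "graph P (Suc t) = (if r then merge x y G else add_edge x y G)"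
      using act by (simp add: graph_Suc update_graph_cases x_def y_def G_def q_def r_def)
    have V: "linked ((q, r) # h) U a b"
      if "v \<in> verts (graph P (Suc t))" "v \<subseteq> U" "a \<in> v" "b \<in> v" for v a b
    proof (cases "v \<in> verts G")
      case True
      then show ?thesis using IHv that by blast
    next
      case False
      then have "v = x \<union> y" using that(1) by (auto simp: gS verts_merge split: if_splits)
      then have "linked ((q, r) # h) U a (fst q)" "linked ((q, r) # h) U b (fst q)"
        using xy that by simp_all
      then show ?thesis using linked_trans linked_sym by metis
    qed
    have E: "linked ((q, r) # h) U a b"
      if e: "{v, w} \<in> edges (graph P (Suc t))" and U: "v \<subseteq> U" "w \<subseteq> U" and ab: "a \<in> v" "b \<in> w" for v w a b
    proof (cases r)
      case True
      \<comment> \<open>The edge to \<open>w'\<close> starts at \<open>x\<close> or at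
        \<open>y\<close>; from the other one the route passes through the new query.\<close>
      have new: "linked ((q, r) # h) U a' b'"
        if "{x, w'} \<in> edges G \<or> {y, w'} \<in> edges G" "x \<union> y \<subseteq> U" "w' \<subseteq> U" "a' \<in> x \<union> y" "b' \<in> w'" for a' b' w'
      proof -
        have U: "x \<subseteq> U" "y \<subseteq> U" using that(2) by auto
        have "linked ((q, r) # h) U (fst q) b' \<or> linked ((q, r) # h) U (snd q) b'"
          using that(1) IHe[OF _ U(1) that(3) fx(1) that(5)] IHe[OF _ U(2) that(3) fx(2) that(5)] by blast
        then have "linked ((q, r) # h) U (fst q) b'"
          using linked_trans[OF q[OF U]] by blast
        then show ?thesis using linked_trans[OF xy[OF U that(4)]] by blast
      qed
      have "{v, w} \<in> edges (merge x y G)" using e True by (simp add: gS)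
      then show ?thesis
      proof (rule edges_mergeE[OF wf adm(3-6)])
        fix v' w' assume "{v, w} = {v', w'}" "{v', w'} \<in> edges G"
        then have "{v, w} \<in> edges G" by simp
        then show ?thesis using IHe U ab by blast
      next
        fix w' assume w': "{v, w} = {x \<union> y, w'}" "{x, w'} \<in> edges G \<or> {y, w'} \<in> edges G"
        then consider "v = x \<union> y" "w = w'" | "w = x \<union> y" "v = w'" by (auto simp: doubleton_eq_iff)
        then show ?thesis
        proof cases
          case 1
          then show ?thesis using new[OF w'(2)] U ab by blast
        next
          case 2
          then show ?thesis using linked_sym[OF new[OF w'(2)]] U ab by blast
        qed
      qed
    next
      case False
      then consider "{v, w} \<in> edges G" | "v = x" "w = y" | "v = y" "w = x"
        using e by (auto simp: gS doubleton_eq_iff)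
      then show ?thesis
      proof cases
        case 1
        then show ?thesis using IHe U ab by blast
      next
        case 2
        then have "linked ((q, r) # h) U a (fst q)" "linked ((q, r) # h) U b (fst q)"
          using xy U ab by auto
        then show ?thesis using linked_trans linked_sym by metis
      next
        case 3
        then have "linked ((q, r) # h) U a (fst q)" "linked ((q, r) # h) U b (fst q)"
          using xy U ab by auto
        then show ?thesis using linked_trans linked_sym by metis
      qed
    qed
    show ?thesis unfolding hS using V E by blast
  qed
qed

lemma linked_vertex:
  assumes "partition_on S P" "v \<in> verts (graph P t)" "v \<subseteq> U" "a \<in> v" "b \<in> v"
  shows "linked (hist P t) U a b"
  using linked_graph[OF assms(1)] assms(2-) by blast

lemma linked_edge:
  assumes "partition_on S P" "{v, w} \<in> edges (graph P t)" "v \<subseteq> U" "w \<subseteq> U" "a \<in> v" "b \<in> w"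
  shows "linked (hist P t) U a b"
  using linked_graph[OF assms(1), of t U] assms(2-) by blast

section \<open>Queries joining two classes inside a union of blocks\<close>

definition separating :: "nat \<Rightarrow> 'a set set \<Rightarrow> 'a set \<Rightarrow> bool" where
  "separating t P U \<longleftrightarrow> active P t \<and> fst (query P t) \<in> U \<and> snd (query P t) \<in> U \<and>
     \<not> linked (hist P t) U (fst (query P t)) (snd (query P t))"

text \<open>The number of classes is a potential: it starts with the \<open>card U\<close>
  singletons, and each separating query uses up one class.\<close>

lemma sum_separating:
  assumes "finite U"
  shows "(\<Sum>t<N. of_bool (separating t P U)) + card (link_classes (hist P N) U) = card U"
proof (induction N)
  case 0
  have "inj_on (\<lambda>u. {u}) U" by (auto intro: inj_onI)
  then show ?case by (simp add: card_image)
next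
  case (Suc N)
  have "card (link_classes (hist P (Suc N)) U) + of_bool (separating N P U) = card (link_classes (hist P N) U)"
    using card_link_classes_Cons[OF assms, of "fst (query P N)" "snd (query P N)" "answer P N" "hist P N"]
    by (auto simp: hist_Suc separating_def simp del: run.simps)
  then show ?case using Suc by simp
qed

text \<open>In the final complete graph the vertices inside \<open>B \<union> B'\<close> are
  pairwise adjacent, so a single class remains, whatever the algorithm. Admitting \<open>{}\<close>
  covers the case of one block.\<close>

lemma card_separating:
  assumes P: "partition_on S P" and B: "B \<in> insert {} P" "B' \<in> insert {} P" "B \<union> B' \<noteq> {}"
  shows "(\<Sum>t<card S * card S. of_bool (separating t P (B \<union> B'))) = card (B \<union> B') - (1::nat)"
proof -
  let ?N = "card S * card S" and ?U = "B \<union> B'"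
  have US: "?U \<subseteq> S" using B partition_on_subset[OF P] by blast
  have "link_classes (hist P ?N) ?U = {?U}"
  proof -
    note wf = wf_graph[OF P, of ?N]
    have l: "linked (hist P ?N) ?U a b" if ab: "a \<in> ?U" "b \<in> ?U" for a b
    proof -
      let ?v = "vertex_of (graph P ?N) a" and ?w = "vertex_of (graph P ?N) b"
      have m: "?v \<in> verts (graph P ?N)" "a \<in> ?v" "?w \<in> verts (graph P ?N)" "b \<in> ?w"
        using vertex_of_mem[OF wf] ab US by auto
      have "?v \<subseteq> ?U" "?w \<subseteq> ?U"
        using consistent_block[OF P consistent_graph[OF P] m(1), of _ a]
          consistent_block[OF P consistent_graph[OF P] m(3), of _ b] B(1,2) m(2,4) ab by blast+
      moreover have "?v = ?w \<or> {?v, ?w} \<in> edges (graph P ?N)"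
        using complete_at[OF P order_refl] m unfolding complete_graph_def by blast
      ultimately show ?thesis
        using linked_vertex[OF P m(1), of ?U a b] linked_edge[OF P, of ?v ?w ?N ?U a b] m by auto
    qed
    note pl = partition_on_link_classes[of ?U "hist P ?N"]
    have "K = ?U" if K: "K \<in> link_classes (hist P ?N) ?U" for K
    proof -
      obtain a where a: "a \<in> K" using K partition_onD3[OF pl] by fastforce
      have "b \<in> K" if "b \<in> ?U" for b
      proof -
        have "a \<in> ?U" using partition_on_subset[OF pl K] a by blast
        then obtain K' where "K' \<in> link_classes (hist P ?N) ?U" "a \<in> K'" "b \<in> K'"
          using l[of a b] \<open>b \<in> ?U\<close> unfolding linked_def by blast
        then show ?thesis using partition_on_unique[OF pl _ K _ a] by blast
      qed
      then show ?thesis using partition_on_subset[OF pl K] by blast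
    qed
    moreover have "link_classes (hist P ?N) ?U \<noteq> {}" using partition_onD1[OF pl] B(3) by fastforce
    ultimately show ?thesis by blast
  qed
  then show ?thesis
    using sum_separating[OF finite_subset[OF US finite_S], of P ?N] by (simp del: run.simps)
qed

text \<open>Each positive answer removes one vertex; the run starts with the items as vertices and
  ends with the blocks.\<close>

lemma sum_positive:
  assumes P: "partition_on S P"
  shows "(\<Sum>t<card S * card S. of_bool (active P t \<and> answer P t)) = card S - card P"
proof -
  have *: "(\<Sum>t<N. of_bool (active P t \<and> answer P t)) + card (verts (graph P N)) = card S" for N
  proof (induction N)
    case 0
    have "inj_on (\<lambda>u. {u}) S" by (auto intro: inj_onI)
    then show ?case by (simp add: graph_0 initial_graph_def card_image)
  next
    case (Suc N)
    have "card (verts (graph P (Suc N))) + of_bool (active P N \<and> answer P N) = card (verts (graph P N))"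
    proof (cases "active P N")
      case True
      note adm = admissible_queryD[OF wf_graph[OF P] admissible[OF P True]]
      show ?thesis
        using card_verts_merge[OF wf_graph[OF P] adm(3-6) finite_S] True by (simp add: graph_Suc update_graph_cases)
    qed (simp add: graph_Suc)
    then show ?case using Suc by simp
  qed
  let ?N = "card S * card S"
  note wf = wf_graph[OF P, of ?N] and con = consistent_graph[OF P, of ?N]
  \<comment> \<open>A second final vertex inside \<open>B\<close> would be adjacent to
    \<open>v\<close>, against consistency.\<close>
  have block: "B = v" if v: "v \<in> verts (graph P ?N)" and B: "B \<in> P" and "v \<subseteq> B" for v B
  proof -
    have "b \<in> v" if "b \<in> B" for b
    proof -
      let ?w = "vertex_of (graph P ?N) b"
      have m: "?w \<in> verts (graph P ?N)" "b \<in> ?w"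
        using vertex_of_mem[OF wf] partition_on_subset[OF P B] that by auto
      have "?w \<subseteq> B" using consistent_block[OF P con m(1) B m(2) that] .
      then have "{v, ?w} \<notin> edges (graph P ?N)" using con B \<open>v \<subseteq> B\<close> unfolding consistent_def by blast
      then have "v = ?w" using complete_at[OF P order_refl] m v unfolding complete_graph_def by blast
      then show ?thesis using m by blast
    qed
    then show ?thesis using \<open>v \<subseteq> B\<close> by blast
  qed
  have "verts (graph P ?N) = P"
  proof
    show "verts (graph P ?N) \<subseteq> P" using block con unfolding consistent_def by blast
    show "P \<subseteq> verts (graph P ?N)"
    proof
      fix B assume B: "B \<in> P"
      then obtain b where b: "b \<in> B" using partition_onD3[OF P] by fastforce
      then have "b \<in> S" using partition_on_subset[OF P B] by blast
      note m = vertex_of_mem[OF wf this]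
      show "B \<in> verts (graph P ?N)"
        using block[OF m(1) B consistent_block[OF P con m(1) B m(2) b]] m(1) by simp
    qed
  qed
  then show ?thesis using *[of ?N] by simp
qed

text \<open>The run sees only the glued partition; the marked sets fix the union inside which links
  are observed.\<close>

abbreviation "event t z \<equiv> separating t (glue z) (fst (snd z) \<union> snd (snd z))"

text \<open>Exchanging the two sides on the class of the second queried item alters no earlier answer,
  since no earlier query within \<open>C \<union> D\<close> leaves that class; it reverses the current answer.\<close>

definition flip :: "nat \<Rightarrow> 'a set set \<times> 'a set \<times> 'a set \<Rightarrow> 'a set set \<times> 'a set \<times> 'a set" where
  "flip t z = (case z of (R, C, D) \<Rightarrow>
     (let K = {b. linked (hist (glue z) t) (C \<union> D) (snd (query (glue z) t)) b}
      in (R, (C - K) \<union> (D \<inter> K), (D - K) \<union> (C \<inter> K))))"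

text \<open>Because the run up to time \<open>t\<close> is unchanged, so are the query and the class
  \<open>K\<close>; hence the same exchange undoes itself and \<open>flip t\<close> is an involution
  on the events at time \<open>t\<close>.\<close>

lemma
  assumes z: "z \<in> bisected_partitions S" and ev: "event t z"
  shows flip_mem: "flip t z \<in> bisected_partitions S"
    and run_flip: "run S A (glue (flip t z)) t = run S A (glue z) t"
    and event_flip: "event t (flip t z)"
    and flip_flip: "flip t (flip t z) = z"
    and fst_query_flip: "fst (query (glue z) t) \<in> fst (snd (flip t z)) \<longleftrightarrow> fst (query (glue z) t) \<in> fst (snd z)"
    and snd_query_flip: "snd (query (glue z) t) \<in> fst (snd (flip t z)) \<longleftrightarrow> snd (query (glue z) t) \<in> snd (snd z)"
proof -
  obtain R C D where zz: "z = (R, C, D)" by (cases z)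
  have z': "C \<inter> D = {}" "C \<union> D \<noteq> {}" "C \<union> D \<subseteq> S" "partition_on (S - (C \<union> D)) R"
    using z unfolding zz bisected_partitions_def by auto
  define q where "q = query (glue z) t"
  define h where "h = hist (glue z) t"
  define K where "K = {b. linked h (C \<union> D) (snd q) b}"
  define C' where "C' = (C - K) \<union> (D \<inter> K)"
  define D' where "D' = (D - K) \<union> (C \<inter> K)"
  have f: "flip t z = (R, C', D')"
    by (simp add: flip_def zz K_def h_def q_def C'_def D'_def Let_def)
  have U: "C' \<union> D' = C \<union> D" and dis: "C' \<inter> D' = {}" using z' by (auto simp: C'_def D'_def)
  have ev': "fst q \<in> C \<union> D" "snd q \<in> C \<union> D" "\<not> linked h (C \<union> D) (fst q) (snd q)" "active (glue z) t"
    using ev by (auto simp: separating_def zz q_def h_def)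
  \<comment> \<open>The two queried items are not linked, so only the second one changes
    sides.\<close>
  have K: "snd q \<in> K" "fst q \<notin> K"
    using linked_refl[OF ev'(2)] ev'(3) linked_sym[of h "C \<union> D" "snd q" "fst q"] unfolding K_def by auto
  show fm: "flip t z \<in> bisected_partitions S" 
    unfolding f bisected_partitions_def mem_Collect_eq prod.case U using z' dis by blast
  show run: "run S A (glue (flip t z)) t = run S A (glue z) t"
  proof (rule run_agree)
    fix q' r assume qr: "(q', r) \<in> set (hist (glue z) t)"
    obtain a b where q': "q' = (a, b)" by (cases q')
    have r: "oracle_answer (glue z) (a, b) = r" using hist_answer[OF qr] q' by simp
    \<comment> \<open>An earlier pair inside \<open>C \<union> D\<close> is linked, so its items
      move together or not at all. The answer to any other pair depends on \<open>R\<close>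
      alone.\<close>
    have "a \<in> K \<longleftrightarrow> b \<in> K" if "a \<in> C \<union> D" "b \<in> C \<union> D"
    proof -
      have "linked h (C \<union> D) a b" using linked_query[of a b r h] that qr q' by (simp add: h_def)
      then show ?thesis
        unfolding K_def mem_Collect_eq using linked_trans linked_sym by metis
    qed
    then have "a \<in> C' \<and> b \<in> C' \<or> a \<in> D' \<and> b \<in> D' \<longleftrightarrow> a \<in> C \<and> b \<in> C \<or> a \<in> D \<and> b \<in> D"
      using z'(1) unfolding C'_def D'_def by blast
    then show "oracle_answer (glue (flip t z)) q' = r"
      using r[unfolded zz oracle_answer_glue] unfolding f q' oracle_answer_glue by blast
  qed
  then have same: "query (glue (flip t z)) t = query (glue z) t" "graph (glue (flip t z)) t = graph (glue z) t"
    by (simp_all add: next_query_def aggregated_graph_def)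
  show "event t (flip t z)"
  proof -
    have "fst (snd (flip t z)) \<union> snd (snd (flip t z)) = fst (snd z) \<union> snd (snd z)"
      using U unfolding f by (simp add: zz)
    then show ?thesis using ev unfolding separating_def same run by simp
  qed
  show "flip t (flip t z) = z"
  proof -
    have "flip t (R, C', D') = (R, (C' - K) \<union> (D' \<inter> K), (D' - K) \<union> (C' \<inter> K))"
      using same(1)[unfolded f] run[unfolded f] U by (simp add: flip_def Let_def K_def h_def q_def)
    moreover have "(C' - K) \<union> (D' \<inter> K) = C" "(D' - K) \<union> (C' \<inter> K) = D"
      unfolding C'_def D'_def by blast+
    ultimately show ?thesis unfolding f by (simp add: zz)
  qed
  show "fst (query (glue z) t) \<in> fst (snd (flip t z)) \<longleftrightarrow> fst (query (glue z) t) \<in> fst (snd z)"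
    using K unfolding f q_def[symmetric] by (simp add: zz C'_def)
  show "snd (query (glue z) t) \<in> fst (snd (flip t z)) \<longleftrightarrow> snd (query (glue z) t) \<in> snd (snd z)"
    using K unfolding f q_def[symmetric] by (simp add: zz C'_def)
qed

lemma mem_glue: "z \<in> bisected_partitions S \<Longrightarrow> fst (snd z) \<in> insert {} (glue z) \<and> snd (snd z) \<in> insert {} (glue z)"
  by (auto simp: glue_def)

section \<open>Events sorted by the sides of the queried items\<close>

definition events :: "nat \<Rightarrow> ('a set set \<times> 'a set \<times> 'a set) set" where
  "events t = {z \<in> bisected_partitions S. event t z}"

text \<open>Both items of an event lie in the disjoint union of \<open>C\<close> and
  \<open>D\<close>, so not being in \<open>C\<close> means being in \<open>D\<close>. The cases with
  \<open>r \<noteq> s\<close> are those with a negative answer.\<close>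

definition side :: "nat \<Rightarrow> bool \<Rightarrow> bool \<Rightarrow> ('a set set \<times> 'a set \<times> 'a set) set" where
  "side t r s = {z \<in> events t. (fst (query (glue z) t) \<in> fst (snd z)) = r \<and> (snd (query (glue z) t) \<in> fst (snd z)) = s}"

lemma finite_events: "finite (events t)"
  using finite_bisected_partitions[OF finite_S] by (simp add: events_def)

lemma card_events_sides: "card (events t) = card (side t True True) + card (side t True False)
    + card (side t False True) + card (side t False False)"
proof -
  have fin: "finite (side t r s)" for r s using finite_events by (simp add: side_def)
  have "events t = (side t True True \<union> side t True False) \<union> (side t False True \<union> side t False False)"
    by (auto simp: side_def)
  also have "card \<dots> = card (side t True True \<union> side t True False) + card (side t False True \<union> side t False False)"
    by (intro card_Un_disjoint finite_UnI fin) (auto simp: side_def)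
  also have "card (side t True True \<union> side t True False) = card (side t True True) + card (side t True False)"
    by (intro card_Un_disjoint finite_UnI fin) (auto simp: side_def)
  also have "card (side t False True \<union> side t False False) = card (side t False True) + card (side t False False)"
    by (intro card_Un_disjoint finite_UnI fin) (auto simp: side_def)
  finally show ?thesis by simp
qed

lemma eventsD:
  assumes "(R, C, D) \<in> events t"
  shows "C \<inter> D = {}" "fst (query (glue (R, C, D)) t) \<in> C \<union> D" "snd (query (glue (R, C, D)) t) \<in> C \<union> D"
  using assms by (auto simp: events_def separating_def bisected_partitions_def)

lemma query_sides:
  assumes "z \<in> events t"
  shows "fst (query (glue z) t) \<in> snd (snd z) \<longleftrightarrow> fst (query (glue z) t) \<notin> fst (snd z)"
    and "snd (query (glue z) t) \<in> snd (snd z) \<longleftrightarrow> snd (query (glue z) t) \<notin> fst (snd z)"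
  using assms by (auto simp: events_def separating_def bisected_partitions_def)

text \<open>The flip keeps the side of the first item and changes that of the second, so it pairs
  positive with negative answers.\<close>

lemma card_side_flip: "card (side t r True) = card (side t r False)"
proof (rule bij_betw_same_card, rule bij_betw_byWitness[where f = "flip t" and f' = "flip t"])
  have flip: "flip t z \<in> side t r (\<not> s)" if "z \<in> side t r s" for z s
  proof -
    have ev: "z \<in> events t" using that by (simp add: side_def)
    have e: "z \<in> bisected_partitions S" "event t z" using that by (auto simp: side_def events_def)
    have q: "query (glue (flip t z)) t = query (glue z) t"
      using run_flip[OF e] by (simp add: next_query_def)
    show ?thesis
      using that flip_mem[OF e] event_flip[OF e] fst_query_flip[OF e] snd_query_flip[OF e] query_sides(2)[OF ev]
      unfolding side_def events_def mem_Collect_eq q by blast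
  qed
  show "flip t ` side t r True \<subseteq> side t r False" "flip t ` side t r False \<subseteq> side t r True"
    using flip by fastforce+
  show "\<forall>z\<in>side t r True. flip t (flip t z) = z" "\<forall>z\<in>side t r False. flip t (flip t z) = z"
    using flip_flip by (auto simp: side_def events_def)
qed

text \<open>Renaming \<open>C\<close> as \<open>D\<close> and conversely changes neither the glued
  partition nor its run. Together with the two instances of \<open>card_side_flip\<close>, each of
  the four cases is a quarter of the events.\<close>

lemma card_side_swap: "card (side t True False) = card (side t False True)"
proof -
  define f where "f = (\<lambda>(R, C, D). (R, D, C) :: 'a set set \<times> 'a set \<times> 'a set)"
  have glue: "glue (f z) = glue z" for z by (auto simp: f_def glue_def split: prod.splits)
  have un: "fst (snd (f z)) \<union> snd (snd (f z)) = fst (snd z) \<union> snd (snd z)" for z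
    by (auto simp: f_def split: prod.splits)
  have T: "f z \<in> bisected_partitions S" if "z \<in> bisected_partitions S" for z
    using that by (auto simp: f_def bisected_partitions_def Un_commute Int_commute)
  have swap: "f z \<in> side t (\<not> r) r" if "z \<in> side t r (\<not> r)" for z r
  proof -
    obtain R C D where z: "z = (R, C, D)" by (cases z)
    have "f z \<in> events t" using that T unfolding side_def events_def mem_Collect_eq glue un by blast
    moreover have "fst (snd (f z)) = snd (snd z)" by (simp add: f_def z)
    ultimately show ?thesis
      using that query_sides[of z t] unfolding side_def mem_Collect_eq glue by auto
  qed
  have "bij_betw f (side t True False) (side t False True)"
    using swap[of _ True] swap[of _ False]
    by (intro bij_betw_byWitness[where f' = f]) (auto simp: f_def)
  then show ?thesis by (rule bij_betw_same_card)
qed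

text \<open>For a negative query the marked pair is determined: \<open>C\<close> is the block of the
  first item and \<open>D\<close> that of the second. Being an event then says that the items are
  not linked inside \<open>C \<union> D\<close>, which is being unforced, so \<open>glue\<close> is
  a bijection.\<close>

lemma card_side_unforced: "card (side t True False) = card {P. partition_on S P \<and> unforced P t}"
proof (rule bij_betw_same_card, rule bij_betwI')
  fix z z' assume zs: "z \<in> side t True False" "z' \<in> side t True False"
  obtain R C D R' C' D' where z: "z = (R, C, D)" "z' = (R', C', D')" by (cases z; cases z') auto
  have T: "z \<in> bisected_partitions S" "z' \<in> bisected_partitions S"
    using zs by (auto simp: side_def events_def)
  note P = partition_on_glue[OF T(1)]
  show "glue z = glue z' \<longleftrightarrow> z = z'"
  proof
    assume eq: "glue z = glue z'"
    define q where "q = query (glue z) t"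
    have q: "fst q \<in> C" "snd q \<in> D" "fst q \<in> C'" "snd q \<in> D'"
      using zs eventsD[of R C D t] eventsD[of R' C' D' t] z eq by (auto simp: side_def q_def)
    have m: "C \<in> glue z" "D \<in> glue z" using q by (auto simp: z glue_def)
    have m': "C' \<in> glue z'" "D' \<in> glue z'" using q by (auto simp: z glue_def)
    have CD: "C = C'" "D = D'"
      using partition_on_unique[OF P m(1) m'(1)[folded eq] q(1,3)]
        partition_on_unique[OF P m(2) m'(2)[folded eq] q(2,4)] by auto
    have "C \<notin> R" "D \<notin> R" "C' \<notin> R'" "D' \<notin> R'"
      using T q unfolding z bisected_partitions_def by (auto dest!: partition_on_subset)
    \<comment> \<open>Both marked sets contain a queried item, hence are nonempty and survive in
      \<open>glue z\<close>; removing them gives back \<open>R\<close>.\<close>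
    then have "R = glue z - {C, D}" "R' = glue z' - {C', D'}"
      unfolding z glue_def prod.case by blast+
    then have "R = R'" using eq CD by simp
    then show "z = z'" using CD z by simp
  qed simp
next
  fix z assume zs: "z \<in> side t True False"
  obtain R C D where z: "z = (R, C, D)" by (cases z) auto
  define q where "q = query (glue z) t"
  have T: "z \<in> bisected_partitions S" and ev: "event t z" using zs by (auto simp: side_def events_def)
  note P = partition_on_glue[OF T]
  have q: "fst q \<in> C" "snd q \<in> D" "snd q \<notin> C"
    using zs eventsD[of R C D t] z by (auto simp: side_def q_def)
  have CD: "C \<in> glue z" "D \<in> glue z" using q by (auto simp: z glue_def)
  have "\<not> answer (glue z) t" using oracle_answer_iff[OF P CD(1) q(1), of "snd q"] q(3) by (simp add: q_def)
  moreover have "active (glue z) t" using ev by (simp add: separating_def)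
  moreover have "\<not> forced (glue z) t"
  proof
    assume "forced (glue z) t"
    then obtain B B' where "B \<in> glue z" "B' \<in> glue z" "fst q \<in> B" "snd q \<in> B'"
        "linked (hist (glue z) t) (B \<union> B') (fst q) (snd q)"
      unfolding forced_def q_def by blast
    moreover from this have "B = C" "B' = D"
      using partition_on_unique[OF P] CD q by blast+
    ultimately show False using ev by (simp add: separating_def z q_def)
  qed
  ultimately show "glue z \<in> {P. partition_on S P \<and> unforced P t}"
    using P by (simp add: unforced_def)
next
  fix P assume "P \<in> {P. partition_on S P \<and> unforced P t}"
  then have P: "partition_on S P" and u: "unforced P t" by auto
  define q where "q = query P t"
  have act: "active P t" "\<not> answer P t" and nf: "\<not> forced P t" using u by (auto simp: unforced_def)
  note adm = admissible_queryD[OF wf_graph[OF P] admissible[OF P act(1)], folded q_def]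
  obtain B where B: "B \<in> P" "fst q \<in> B" using partition_on_obtain[OF P adm(1)] .
  obtain B' where B': "B' \<in> P" "snd q \<in> B'" using partition_on_obtain[OF P adm(2)] .
  have "snd q \<notin> B" using act(2) oracle_answer_iff[OF P B, of "snd q"] by (simp add: q_def)
  then have ne: "B \<noteq> B'" using B' by blast
  have dis: "B \<inter> B' = {}" using partition_on_unique[OF P B(1) B'(1)] ne by blast
  define z where "z = (P - {B, B'}, B, B')"
  have glue: "glue z = P" using B B' by (auto simp: z_def glue_def)
  have "partition_on (S - (B \<union> B')) (P - {B, B'})"
  proof (rule partition_onI)
    have d: "X \<inter> Y = {}" if "X \<in> P" "Y \<in> P" "X \<noteq> Y" for X Y
      using that partition_on_unique[OF P] by blast
    show "\<Union>(P - {B, B'}) = S - (B \<union> B')"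
    proof (rule set_eqI)
      fix a
      have "X = B" if "X \<in> P" "a \<in> X" "a \<in> B" for X
        using partition_on_unique[OF P that(1) B(1) that(2,3)] .
      moreover have "X = B'" if "X \<in> P" "a \<in> X" "a \<in> B'" for X
        using partition_on_unique[OF P that(1) B'(1) that(2,3)] .
      moreover have "a \<in> S \<longleftrightarrow> (\<exists>X\<in>P. a \<in> X)" using partition_onD1[OF P] by blast
      ultimately show "a \<in> \<Union>(P - {B, B'}) \<longleftrightarrow> a \<in> S - (B \<union> B')" using B(1) B'(1) by auto
    qed
    show "disjnt X Y" if "X \<in> P - {B, B'}" "Y \<in> P - {B, B'}" "X \<noteq> Y" for X Y
      using d that by (simp add: disjnt_def)
    show "{} \<notin> P - {B, B'}" using partition_onD3[OF P] by blast
  qed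
  then have T: "z \<in> bisected_partitions S"
    using B B' dis partition_on_subset[OF P] by (auto simp: z_def bisected_partitions_def)
  have "event t z"
    unfolding glue separating_def q_def[symmetric]
    using act nf B B' by (auto simp: z_def forced_def q_def)
  then have "z \<in> side t True False"
    using T B \<open>snd q \<notin> B\<close> unfolding side_def events_def mem_Collect_eq glue q_def[symmetric] by (simp add: z_def)
  then show "\<exists>z\<in>side t True False. P = glue z" using glue by blast
qed

text \<open>Double counting over times and marked partitions by \<open>card_separating\<close>. No
  run enters the resulting value, so it is the same for all algorithms.\<close>

lemma sum_card_events:
  "(\<Sum>t<card S * card S. card (events t)) =
    (\<Sum>z\<in>bisected_partitions S. card (fst (snd z) \<union> snd (snd z)) - 1)"
proof -
  note fin = finite_bisected_partitions[OF finite_S]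
  have "(\<Sum>t<card S * card S. card (events t)) =
      (\<Sum>t<card S * card S. \<Sum>z\<in>bisected_partitions S. of_bool (event t z))"
    using fin by (simp add: events_def sum_of_bool_eq Int_def)
  also have "\<dots> = (\<Sum>z\<in>bisected_partitions S. \<Sum>t<card S * card S. of_bool (event t z))"
    by (rule sum.swap)
  also have "\<dots> = (\<Sum>z\<in>bisected_partitions S. card (fst (snd z) \<union> snd (snd z)) - 1)"
  proof (rule sum.cong[OF refl])
    fix z assume z: "z \<in> bisected_partitions S"
    have "fst (snd z) \<union> snd (snd z) \<noteq> {}" using z by (auto simp: bisected_partitions_def)
    then show "(\<Sum>t<card S * card S. of_bool (event t z)) = card (fst (snd z) \<union> snd (snd z)) - 1"
      using card_separating[OF partition_on_glue[OF z]] mem_glue[OF z] by blast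
  qed
  finally show ?thesis .
qed

text \<open>Each query is answered positively, is an unforced negative one, or is forced. The
  unforced ones make up a quarter of the events, and the factor 4 keeps the identity in the natural
  numbers. Only the last summand depends on \<open>A\<close>.\<close>

lemma sum_complexity:
  "4 * (\<Sum>P | partition_on S P. complexity S A P) =
     4 * (\<Sum>P | partition_on S P. card S - card P)
     + (\<Sum>z\<in>bisected_partitions S. card (fst (snd z) \<union> snd (snd z)) - 1)
     + 4 * (\<Sum>P | partition_on S P. \<Sum>t<card S * card S. of_bool (forced P t))"
proof -
  let ?\<Pi> = "{P. partition_on S P}" and ?N = "card S * card S"
  have fin: "finite ?\<Pi>" using finitely_many_partition_on[OF finite_S] .
  have "complexity S A P = (card S - card P) + (\<Sum>t<?N. of_bool (unforced P t)) + (\<Sum>t<?N. of_bool (forced P t))"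
    if "P \<in> ?\<Pi>" for P
  proof -
    have "complexity S A P = (\<Sum>t<?N. of_bool (active P t))"
      using that by (simp add: complexity_eq sum_of_bool_eq Int_def)
    also have "\<dots> = (\<Sum>t<?N. of_bool (active P t \<and> answer P t) + of_bool (unforced P t) + of_bool (forced P t))"
      by (intro sum.cong) (auto simp: unforced_def forced_def)
    finally show ?thesis using sum_positive[of P] that by (simp add: sum.distrib)
  qed
  then have "(\<Sum>P\<in>?\<Pi>. complexity S A P) = (\<Sum>P\<in>?\<Pi>. card S - card P)
      + (\<Sum>P\<in>?\<Pi>. \<Sum>t<?N. of_bool (unforced P t)) + (\<Sum>P\<in>?\<Pi>. \<Sum>t<?N. of_bool (forced P t))"
    by (simp add: sum.distrib)
  moreover have "4 * (\<Sum>P\<in>?\<Pi>. \<Sum>t<?N. of_bool (unforced P t)) = (\<Sum>t<?N. card (events t))"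
  proof -
    have "(\<Sum>P\<in>?\<Pi>. \<Sum>t<?N. of_bool (unforced P t)) = (\<Sum>t<?N. \<Sum>P\<in>?\<Pi>. of_bool (unforced P t))"
      by (rule sum.swap)
    also have "\<dots> = (\<Sum>t<?N. card (side t True False))"
      using fin by (simp add: sum_of_bool_eq card_side_unforced Int_def)
    finally have "4 * (\<Sum>P\<in>?\<Pi>. \<Sum>t<?N. of_bool (unforced P t)) = (\<Sum>t<?N. 4 * card (side t True False))"
      by (simp add: sum_distrib_left)
    also have "\<dots> = (\<Sum>t<?N. card (events t))"
      using card_side_flip[of _ True] card_side_flip[of _ False] card_side_swap
      by (intro sum.cong) (auto simp: card_events_sides)
    finally show ?thesis .
  qed
  ultimately show ?thesis using sum_card_events by simp
qed

end

section \<open>Induced paths and cycles\<close>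

definition induced_path :: "'v graph \<Rightarrow> 'v list \<Rightarrow> bool" where
  "induced_path G p \<longleftrightarrow> distinct p \<and> set p \<subseteq> verts G \<and>
     (\<forall>i<length p. \<forall>j<length p. {p ! i, p ! j} \<in> edges G \<longleftrightarrow> j = Suc i \<or> i = Suc j)"

lemma induced_cycle_rotate1:
  assumes "induced_cycle G c" shows "induced_cycle G (rotate1 c)"
proof -
  let ?n = "length c"
  have c: "3 \<le> ?n" "distinct c" "set c \<subseteq> verts G"
    and e: "\<And>i j. i < ?n \<Longrightarrow> j < ?n \<Longrightarrow> {c ! i, c ! j} \<in> edges G \<longleftrightarrow> j = Suc i mod ?n \<or> i = Suc j mod ?n"
    using assms unfolding induced_cycle_def by auto
  have "{rotate1 c ! i, rotate1 c ! j} \<in> edges G \<longleftrightarrow> j = Suc i mod ?n \<or> i = Suc j mod ?n"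
    if "i < ?n" "j < ?n" for i j
  proof -
    have *: "Suc b mod ?n = Suc (Suc a mod ?n) mod ?n \<longleftrightarrow> b = Suc a mod ?n" if "a < ?n" "b < ?n" for a b
      using that c(1) by (simp add: mod_Suc)
    have "{rotate1 c ! i, rotate1 c ! j} \<in> edges G \<longleftrightarrow>
        {c ! (Suc i mod ?n), c ! (Suc j mod ?n)} \<in> edges G"
      using that by (simp add: nth_rotate1)
    also have "\<dots> \<longleftrightarrow> Suc j mod ?n = Suc (Suc i mod ?n) mod ?n \<or> Suc i mod ?n = Suc (Suc j mod ?n) mod ?n"
      using c(1) by (intro e) (auto intro!: mod_less_divisor)
    finally show ?thesis using *[OF that] *[OF that(2,1)] by simp
  qed
  then show ?thesis using c unfolding induced_cycle_def by simp
qed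

lemma induced_cycle_rotate: "induced_cycle G c \<Longrightarrow> induced_cycle G (rotate k c)"
  by (induction k) (simp_all add: induced_cycle_rotate1)

lemma induced_path_butlast:
  assumes "induced_cycle G c" shows "induced_path G (butlast c)"
  using assms unfolding induced_cycle_def induced_path_def
  by (auto simp: nth_butlast distinct_butlast mod_Suc dest: in_set_butlastD)

lemma nth_doubleton_eq_iff:
  assumes "distinct p" "i < length p" "j < length p" "k < length p" "l < length p"
  shows "{p ! i, p ! j} = {p ! k, p ! l} \<longleftrightarrow> i = k \<and> j = l \<or> i = l \<and> j = k"
  using assms by (simp add: doubleton_eq_iff nth_eq_iff_index_eq)

lemma induced_cycle_close:
  assumes "induced_path G p" "3 \<le> length p"
  shows "induced_cycle (add_edge (p ! 0) (p ! (length p - 1)) G) p"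
proof -
  let ?n = "length p"
  have p: "distinct p" "set p \<subseteq> verts G"
    and e: "\<And>i j. i < ?n \<Longrightarrow> j < ?n \<Longrightarrow> {p ! i, p ! j} \<in> edges G \<longleftrightarrow> j = Suc i \<or> i = Suc j"
    using assms(1) unfolding induced_path_def by auto
  have "{p ! i, p ! j} \<in> edges (add_edge (p ! 0) (p ! (?n - 1)) G) \<longleftrightarrow> j = Suc i mod ?n \<or> i = Suc j mod ?n"
    if ij: "i < ?n" "j < ?n" for i j
  proof -
    have "{p ! i, p ! j} = {p ! 0, p ! (?n - 1)} \<longleftrightarrow> i = 0 \<and> j = ?n - 1 \<or> i = ?n - 1 \<and> j = 0"
      using ij assms(2) by (intro nth_doubleton_eq_iff p(1)) auto
    then show ?thesis using e[OF ij] ij assms(2) by (auto simp: mod_Suc)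
  qed
  then show ?thesis using p assms(2) unfolding induced_cycle_def by simp
qed

lemma induced_path_open:
  assumes c: "induced_cycle (add_edge (c ! 0) (c ! (length c - 1)) G) c"
    and nadj: "{c ! 0, c ! (length c - 1)} \<notin> edges G"
  shows "induced_path G c"
proof -
  let ?n = "length c"
  have p: "3 \<le> ?n" "distinct c" "set c \<subseteq> verts G"
    and e: "\<And>i j. i < ?n \<Longrightarrow> j < ?n \<Longrightarrow> {c ! i, c ! j} \<in> insert {c ! 0, c ! (?n - 1)} (edges G)
        \<longleftrightarrow> j = Suc i mod ?n \<or> i = Suc j mod ?n"
    using c unfolding induced_cycle_def by auto
  have "{c ! i, c ! j} \<in> edges G \<longleftrightarrow> j = Suc i \<or> i = Suc j" if ij: "i < ?n" "j < ?n" for i j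
  proof -
    have "{c ! i, c ! j} = {c ! 0, c ! (?n - 1)} \<longleftrightarrow> i = 0 \<and> j = ?n - 1 \<or> i = ?n - 1 \<and> j = 0"
      using ij p(1) by (intro nth_doubleton_eq_iff p(2)) auto
    then show ?thesis using e[OF ij] ij p(1) nadj
      by (auto simp: mod_Suc insert_commute split: if_splits)
  qed
  then show ?thesis using p unfolding induced_path_def by simp
qed

text \<open>Splits a cycle at one vertex: what remains is an induced path of which \<open>v\<close>
  sees the two ends only. This is used both to remove a merged vertex from a cycle and to put an
  original vertex in its place.\<close>

lemma induced_cycle_Cons:
  assumes "3 \<le> length (v # p)" "{v} \<notin> edges G"
  shows "induced_cycle G (v # p) \<longleftrightarrow> induced_path G p \<and> v \<notin> set p \<and> v \<in> verts G \<and>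
    (\<forall>i<length p. {v, p ! i} \<in> edges G \<longleftrightarrow> i = 0 \<or> i = length p - 1)"
    (is "_ \<longleftrightarrow> ?R")
proof -
  let ?n = "length p"
  have n: "2 \<le> ?n" using assms(1) by simp
  have M: "Suc a mod Suc ?n = (if a = ?n then 0 else Suc a)" if "a < Suc ?n" for a
    using that by auto
  have "(\<forall>i<Suc ?n. \<forall>j<Suc ?n. {(v # p) ! i, (v # p) ! j} \<in> edges G \<longleftrightarrow> j = Suc i mod Suc ?n \<or> i = Suc j mod Suc ?n)
    \<longleftrightarrow> (\<forall>i<?n. {v, p ! i} \<in> edges G \<longleftrightarrow> i = 0 \<or> i = ?n - 1) \<and>
        (\<forall>i<?n. \<forall>j<?n. {p ! i, p ! j} \<in> edges G \<longleftrightarrow> j = Suc i \<or> i = Suc j)"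
    (is "?A \<longleftrightarrow> ?B")
  proof
    assume A: ?A
    have "{v, p ! i} \<in> edges G \<longleftrightarrow> i = 0 \<or> i = ?n - 1" if "i < ?n" for i
      using A[rule_format, of 0 "Suc i"] that n by (auto simp: M split: if_splits)
    moreover have "{p ! i, p ! j} \<in> edges G \<longleftrightarrow> j = Suc i \<or> i = Suc j" if "i < ?n" "j < ?n" for i j
      using A[rule_format, of "Suc i" "Suc j"] that n by (auto simp: M split: if_splits)
    ultimately show ?B by blast
  next
    assume B: ?B
    show ?A
    proof (intro allI impI)
      fix i j assume ij: "i < Suc ?n" "j < Suc ?n"
      show "{(v # p) ! i, (v # p) ! j} \<in> edges G \<longleftrightarrow> j = Suc i mod Suc ?n \<or> i = Suc j mod Suc ?n"
      proof (cases i; cases j)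
        assume "i = 0" "j = 0"
        then show ?thesis using assms(2) n by (auto simp: M)
      next
        fix j' assume "i = 0" "j = Suc j'"
        then show ?thesis using B ij n by (auto simp: M)
      next
        fix i' assume "i = Suc i'" "j = 0"
        then show ?thesis using B ij n by (auto simp: M insert_commute)
      next
        fix i' j' assume "i = Suc i'" "j = Suc j'"
        then show ?thesis using B ij n by (auto simp: M)
      qed
    qed
  qed
  then show ?thesis using assms(1) unfolding induced_cycle_def induced_path_def by auto
qed

lemma induced_path_Cons:
  assumes "induced_path G p" "v \<notin> set p" "v \<in> verts G" "{v} \<notin> edges G"
    and "\<And>i. i < length p \<Longrightarrow> {v, p ! i} \<in> edges G \<longleftrightarrow> i = 0"
  shows "induced_path G (v # p)"
proof -
  have "{(v # p) ! i, (v # p) ! j} \<in> edges G \<longleftrightarrow> j = Suc i \<or> i = Suc j"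
    if "i < Suc (length p)" "j < Suc (length p)" for i j
    using that assms(1,4) assms(5)[of "i - 1"] assms(5)[of "j - 1"] unfolding induced_path_def
    by (cases i; cases j) (auto simp: insert_commute)
  then show ?thesis using assms(1-3) unfolding induced_path_def by simp
qed

lemma induced_path_snoc:
  assumes "induced_path G p" "v \<notin> set p" "v \<in> verts G" "{v} \<notin> edges G"
    and "\<And>i. i < length p \<Longrightarrow> {v, p ! i} \<in> edges G \<longleftrightarrow> i = length p - 1"
  shows "induced_path G (p @ [v])"
proof -
  have "{(p @ [v]) ! i, (p @ [v]) ! j} \<in> edges G \<longleftrightarrow> j = Suc i \<or> i = Suc j"
    if ij: "i < Suc (length p)" "j < Suc (length p)" for i j
  proof -
    consider "i < length p" "j < length p" | "i = length p" "j < length p"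
      | "i < length p" "j = length p" | "i = length p" "j = length p"
      using ij by linarith
    then show ?thesis
      using assms(1,4) assms(5)[of i] assms(5)[of j] unfolding induced_path_def
      by cases (auto simp: nth_append insert_commute)
  qed
  then show ?thesis using assms(1-3) unfolding induced_path_def by simp
qed

lemma induced_cycle_add_edgeD:
  assumes "induced_cycle (add_edge x y G) c \<noteq> induced_cycle G c"
  shows "x \<in> set c" "y \<in> set c"
proof -
  have "\<exists>i<length c. \<exists>j<length c. {c ! i, c ! j} = {x, y}"
  proof (rule ccontr)
    assume "\<not> ?thesis"
    then have "{c ! i, c ! j} \<in> edges (add_edge x y G) \<longleftrightarrow> {c ! i, c ! j} \<in> edges G"
      if "i < length c" "j < length c" for i j using that by auto
    then show False using assms unfolding induced_cycle_def by simp
  qed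
  then show "x \<in> set c" "y \<in> set c" by (auto simp: doubleton_eq_iff)
qed

lemma induced_cycle_edge_iff:
  assumes "induced_cycle G c" "i < length c" "j < length c"
  shows "{c ! i, c ! j} \<in> edges G \<longleftrightarrow> j = Suc i mod length c \<or> i = Suc j mod length c"
  using assms unfolding induced_cycle_def by blast

lemma add_edge_commute: "add_edge x y G = add_edge y x G"
  by (simp add: add_edge_def insert_commute)

lemma rotate_to_front:
  assumes "x \<in> set c" obtains k where "rotate k c \<noteq> []" "rotate k c ! 0 = x"
proof -
  obtain i where "i < length c" "c ! i = x" using assms by (auto simp: in_set_conv_nth)
  moreover from this have "c \<noteq> []" by auto
  ultimately show ?thesis using that[of i] by (auto simp: nth_rotate)
qed

lemma no_loop: "wf_graph S G \<Longrightarrow> {v} \<notin> edges G"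
  using wf_graph_edge(3)[of S G v v] by auto

text \<open>Only the edge \<open>{x, y}\<close> is new, so it is an edge of the cycle. Rotating
  \<open>x\<close> to the front puts \<open>y\<close> last or second; in the latter case one more
  rotation moves \<open>x\<close> to the end. Opening the cycle at this edge leaves a path of
  \<open>G\<close>.\<close>

lemma induced_path_if_new_cycle:
  assumes "induced_cycle (add_edge x y G) c" "\<not> induced_cycle G c" "{x, y} \<notin> edges G" "x \<noteq> y"
  obtains p where "induced_path G p" "length p = length c" "{p ! 0, p ! (length p - 1)} = {x, y}"
proof -
  have "x \<in> set c" using induced_cycle_add_edgeD[of x y G c] assms by blast
  then obtain k where k: "rotate k c \<noteq> []" "rotate k c ! 0 = x" by (rule rotate_to_front)
  define d where "d = rotate k c"
  have d: "induced_cycle (add_edge x y G) d" using induced_cycle_rotate[OF assms(1)] by (simp add: d_def)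
  have n: "3 \<le> length d" "length d = length c" using d by (auto simp: induced_cycle_def d_def)
  have "y \<in> set d" using induced_cycle_add_edgeD(2)[of x y G c] assms by (simp add: d_def)
  then obtain m where m: "m < length d" "d ! m = y" by (auto simp: in_set_conv_nth)
  have d0: "d ! 0 = x" using k by (simp add: d_def)
  have "{d ! 0, d ! m} \<in> edges (add_edge x y G)" using m d0 by simp
  then have "m = Suc 0 mod length d \<or> 0 = Suc m mod length d"
    using induced_cycle_edge_iff[OF d, of 0 m] m(1) n by linarith
  then consider "m = length d - 1" | "m = 1" using m(1) n by (auto simp: mod_Suc split: if_splits)
  then show ?thesis
  proof cases
    case 1
    then have "d ! (length d - 1) = y" using m by simp
    then have "induced_path G d" using induced_path_open[of d G] d d0 assms(3) by simp
    then show ?thesis using that[of d] d0 \<open>d ! (length d - 1) = y\<close> n by simp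
  next
    case 2
    define e where "e = rotate1 d"
    have len: "length e = length d" by (simp add: e_def)
    have "c \<noteq> []" using n by auto
    then have e0: "e ! 0 = y" using m 2 n nth_rotate1[of 0 d] by (simp add: e_def)
    have "Suc (length d - 1) = length d" using n by simp
    then have el: "e ! (length e - 1) = x" using d0 nth_rotate1[of "length d - 1" d] by (simp add: e_def)
    have "induced_cycle (add_edge (e ! 0) (e ! (length e - 1)) G) e"
      using induced_cycle_rotate1[OF d] unfolding e0 el e_def[symmetric] add_edge_commute[of x y] .
    moreover have "{e ! 0, e ! (length e - 1)} \<notin> edges G" unfolding e0 el using assms(3) by (simp add: insert_commute)
    ultimately have "induced_path G e" by (rule induced_path_open)
    then show ?thesis using that[of e] e0 el n len by (simp add: insert_commute)
  qed
qed

text \<open>Since \<open>G\<close> is chordal, the cycle passes through \<open>x \<union> y\<close>.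
  Its other vertices form an induced path in \<open>G\<close> whose ends, and no inner vertices, are
  adjacent to \<open>x\<close> or \<open>y\<close>. At least three vertices remain, and adding
  \<open>x\<close> and \<open>y\<close> at opposite ends gives at least five.\<close>

lemma induced_path_if_merged_cycle:
  assumes wf: "wf_graph S G" and x: "x \<in> verts G" and y: "y \<in> verts G"
    and ne: "x \<noteq> y" and nadj: "{x, y} \<notin> edges G"
    and ch: "chordal G" and c: "induced_cycle (merge x y G) c" and len: "length c \<noteq> 3"
  obtains p where "induced_path G p" "5 \<le> length p" "{p ! 0, p ! (length p - 1)} = {x, y}"
proof -
  note result = that
  note old = edges_merge_old[OF wf x y ne nadj] and new = edges_merge_new[OF wf x y ne nadj]
  have le: "4 \<le> length c" using c len by (auto simp: induced_cycle_def)
  have not_cycle: "\<not> induced_cycle G d" if "length d = length c" for d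
    using ch that len unfolding chordal_def by metis
  have transfer: "induced_path G p" if "induced_path (merge x y G) p" "x \<union> y \<notin> set p" for p
  proof -
    have sub: "set p \<subseteq> verts G - {x, y}" using that unfolding induced_path_def verts_merge by auto
    have "{p ! i, p ! j} \<in> edges (merge x y G) \<longleftrightarrow> {p ! i, p ! j} \<in> edges G"
      if "i < length p" "j < length p" for i j
      using old[of "p ! i" "p ! j"] subsetD[OF sub nth_mem[OF that(1)]] subsetD[OF sub nth_mem[OF that(2)]] by simp
    then show ?thesis using that sub unfolding induced_path_def by auto
  qed
  have "x \<union> y \<in> set c"
  proof (rule ccontr)
    assume n: "x \<union> y \<notin> set c"
    then have sub: "set c \<subseteq> verts G - {x, y}" using c unfolding induced_cycle_def verts_merge by auto
    have "{c ! i, c ! j} \<in> edges (merge x y G) \<longleftrightarrow> {c ! i, c ! j} \<in> edges G"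
      if "i < length c" "j < length c" for i j
      using old[of "c ! i" "c ! j"] subsetD[OF sub nth_mem[OF that(1)]] subsetD[OF sub nth_mem[OF that(2)]] by simp
    then have "induced_cycle G c" using c sub unfolding induced_cycle_def by auto
    then show False using not_cycle by blast
  qed
  then obtain k where k: "rotate k c \<noteq> []" "rotate k c ! 0 = x \<union> y" by (rule rotate_to_front)
  then obtain p where p: "rotate k c = (x \<union> y) # p" by (cases "rotate k c") auto
  have lp: "length c = Suc (length p)" using arg_cong[OF p, of length] by simp
  have "induced_cycle (merge x y G) ((x \<union> y) # p)" using induced_cycle_rotate[OF c, of k] p by simp
  then have P: "induced_path (merge x y G) p" "x \<union> y \<notin> set p"
    and adj: "\<And>i. i < length p \<Longrightarrow> {x \<union> y, p ! i} \<in> edges (merge x y G) \<longleftrightarrow> i = 0 \<or> i = length p - 1"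
    using induced_cycle_Cons[of "x \<union> y" p "merge x y G"] no_loop[OF wf_merge[OF wf x y ne nadj]] lp le by auto
  have pG: "induced_path G p" using transfer[OF P] .
  have sub: "set p \<subseteq> verts G" "x \<notin> set p" "y \<notin> set p"
    using P unfolding induced_path_def verts_merge by auto
  have adj': "{x, p ! i} \<in> edges G \<or> {y, p ! i} \<in> edges G \<longleftrightarrow> i = 0 \<or> i = length p - 1" if "i < length p" for i
    using adj[OF that] new[of "p ! i"] nth_mem[OF that] sub(1) by auto
  have l3: "3 \<le> length p" using lp le by simp
  \<comment> \<open>If one of \<open>x\<close>, \<open>y\<close> saw both ends, it could replace the
    merged vertex and give a cycle of the same length in \<open>G\<close>.\<close>
  have cyc: False if v: "v \<in> verts G" "v \<notin> set p" "v = x \<or> v = y"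
      "{v, p ! 0} \<in> edges G" "{v, p ! (length p - 1)} \<in> edges G" for v
  proof -
    have "{v, p ! i} \<in> edges G \<longleftrightarrow> i = 0 \<or> i = length p - 1" if "i < length p" for i
      using adj'[OF that] v by auto
    then have "induced_cycle G (v # p)"
      using induced_cycle_Cons[of v p G] l3 no_loop[OF wf] pG v by auto
    then show False using not_cycle[of "v # p"] lp by simp
  qed
  \<comment> \<open>Each of \<open>v\<close>, \<open>w\<close> sees exactly one end of
    \<open>p\<close>, and \<open>v\<close>, \<open>w\<close> are not adjacent, so extending
    \<open>p\<close> on both sides creates no chord.\<close>
  have path: thesis if vw: "{v, w} = {x, y}" "{v, p ! 0} \<in> edges G" "{w, p ! (length p - 1)} \<in> edges G" for v w
  proof -
    have m: "v \<in> verts G" "w \<in> verts G" "v \<notin> set p" "w \<notin> set p" "v \<noteq> w" "v = x \<or> v = y" "w = x \<or> w = y"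
      using vw(1) x y sub ne by (auto simp: doubleton_eq_iff)
    have nw: "{v, p ! (length p - 1)} \<notin> edges G" "{w, p ! 0} \<notin> edges G"
      using cyc[of v] cyc[of w] vw m by auto
    have "{v, w} \<notin> edges G" unfolding vw(1) by (rule nadj)
    have a: "{v, p ! i} \<in> edges G \<longleftrightarrow> i = 0" if "i < length p" for i
      using adj'[OF that] nw(1) vw(2) m by auto
    have b: "{w, p ! i} \<in> edges G \<longleftrightarrow> i = length p - 1" if "i < length p" for i
      using adj'[OF that] nw(2) vw(3) m by auto
    have vp: "induced_path G (v # p)"
      using induced_path_Cons[OF pG m(3,1) no_loop[OF wf] a] .
    have "induced_path G ((v # p) @ [w])"
    proof (rule induced_path_snoc[OF vp _ m(2) no_loop[OF wf]])
      show "w \<notin> set (v # p)" using m by auto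
      show "{w, (v # p) ! i} \<in> edges G \<longleftrightarrow> i = length (v # p) - 1" if "i < length (v # p)" for i
      proof (cases i)
        case 0
        then show ?thesis using \<open>{v, w} \<notin> edges G\<close> l3 by (auto simp: insert_commute)
      next
        case (Suc j)
        then show ?thesis using b[of j] that l3 by auto
      qed
    qed
    then show thesis
      using result[of "(v # p) @ [w]"] l3 vw(1) by (simp add: nth_append)
  qed
  have "0 < length p" "length p - 1 < length p" using l3 by auto
  then consider "{x, p ! 0} \<in> edges G" "{x, p ! (length p - 1)} \<in> edges G"
    | "{y, p ! 0} \<in> edges G" "{y, p ! (length p - 1)} \<in> edges G"
    | "{x, p ! 0} \<in> edges G" "{y, p ! (length p - 1)} \<in> edges G"
    | "{y, p ! 0} \<in> edges G" "{x, p ! (length p - 1)} \<in> edges G"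
    using adj'[of 0] adj'[of "length p - 1"] by blast
  then show thesis
  proof cases
    case 1
    then show ?thesis using cyc[of x] x sub(2) by blast
  next
    case 2
    then show ?thesis using cyc[of y] y sub(3) by blast
  next
    case 3
    then show ?thesis using path[of x y] by blast
  next
    case 4
    then show ?thesis using path[of y x] by blast
  qed
qed

text \<open>A repetition or a forward chord would shorten a walk of least length. Only pairs with
  \<open>i < j\<close> are treated, which is enough when the relation is symmetric.\<close>

lemma shortest_walk:
  assumes "(x, y) \<in> R\<^sup>*"
  obtains f n where "f 0 = x" "f n = y" "\<forall>i<n. (f i, f (Suc i)) \<in> R"
    "\<forall>j\<le>n. \<forall>i<j. f i \<noteq> f j \<and> ((f i, f j) \<in> R \<longrightarrow> j = Suc i)"
proof -
  define n where "n = (LEAST n. (x, y) \<in> R ^^ n)"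
  have xy: "(x, y) \<in> R ^^ n"
    unfolding n_def using rtrancl_imp_relpow[OF assms] by (rule LeastI_ex)
  have min: "n \<le> m" if "(x, y) \<in> R ^^ m" for m
    unfolding n_def using that by (rule Least_le)
  obtain f where f: "f 0 = x" "f n = y" "\<And>i. i < n \<Longrightarrow> (f i, f (Suc i)) \<in> R"
    using xy unfolding relpow_fun_conv by blast
  have pre: "(x, f i) \<in> R ^^ i" if "i \<le> n" for i
    unfolding relpow_fun_conv using f that by (intro exI[of _ f]) auto
  have suf: "(f j, y) \<in> R ^^ (n - j)" if "j \<le> n" for j
    unfolding relpow_fun_conv using f that by (intro exI[of _ "\<lambda>i. f (j + i)"]) auto
  have "f i \<noteq> f j \<and> ((f i, f j) \<in> R \<longrightarrow> j = Suc i)" if ij: "i < j" "j \<le> n" for i j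
  proof (intro conjI impI)
    show "f i \<noteq> f j"
    proof
      assume "f i = f j"
      then have "(x, y) \<in> R ^^ i O R ^^ (n - j)" using pre[of i] suf[of j] ij by auto
      then have "(x, y) \<in> R ^^ (i + (n - j))" by (simp add: relpow_add)
      then show False using min[of "i + (n - j)"] ij by simp
    qed
    assume "(f i, f j) \<in> R"
    then have "(x, f j) \<in> R ^^ Suc i" using pre[of i] ij by auto
    then have "(x, y) \<in> R ^^ Suc i O R ^^ (n - j)" using suf[of j] ij by blast
    then have "(x, y) \<in> R ^^ (Suc i + (n - j))" by (simp only: relpow_add)
    then show "j = Suc i" using min[of "Suc i + (n - j)"] ij by simp
  qed
  then show ?thesis using that[of f n] f by simp
qed

section \<open>Merging the classes of a proper colouring\<close>

text \<open>Source of alternative partitions: a colouring of the current vertices prescribes which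
  of them will turn out to belong together.\<close>

definition colour_classes :: "('a set \<Rightarrow> 'c) \<Rightarrow> 'a set set \<Rightarrow> 'a set set" where
  "colour_classes c V = (\<lambda>v. \<Union>{w \<in> V. c w = c v}) ` V"

lemma mem_colour_class:
  assumes "partition_on S V" "v \<in> V" "a \<in> v"
  shows "a \<in> \<Union>{w \<in> V. c w = k} \<longleftrightarrow> c v = k"
proof
  assume "a \<in> \<Union>{w \<in> V. c w = k}"
  then obtain w where "w \<in> V" "c w = k" "a \<in> w" by blast
  then show "c v = k" using partition_on_unique[OF assms(1) assms(2) _ assms(3)] by blast
qed (use assms in blast)

lemma partition_on_colour_classes:
  assumes "partition_on S V" shows "partition_on S (colour_classes c V)"
proof (rule partition_onI)
  show "\<Union>(colour_classes c V) = S"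
    unfolding partition_onD1[OF assms] colour_classes_def by blast
  show "{} \<notin> colour_classes c V"
  proof
    assume "{} \<in> colour_classes c V"
    then obtain v where v: "v \<in> V" and eq: "{} = \<Union>{w \<in> V. c w = c v}"
      unfolding colour_classes_def by (rule imageE) simp
    have "v \<subseteq> \<Union>{w \<in> V. c w = c v}" using v by auto
    then have "v = {}" unfolding eq[symmetric] by simp
    then show False using v partition_onD3[OF assms] by simp
  qed
  fix p q assume "p \<in> colour_classes c V" "q \<in> colour_classes c V" "p \<noteq> q"
  then obtain v w where p: "p = \<Union>{u \<in> V. c u = c v}" and q: "q = \<Union>{u \<in> V. c u = c w}"
    unfolding colour_classes_def by (elim imageE) simp
  then have "c v \<noteq> c w" using \<open>p \<noteq> q\<close> by metis
  have "a \<notin> q" if "a \<in> p" for a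
  proof -
    obtain u where u: "u \<in> V" "c u = c v" "a \<in> u" using \<open>a \<in> p\<close> p by blast
    show ?thesis using mem_colour_class[OF assms u(1,3), of c "c w"] u(2) \<open>c v \<noteq> c w\<close> q by simp
  qed
  then show "disjnt p q" by (auto simp: disjnt_def)
qed

text \<open>Blocks are unions of whole vertices, and properness keeps adjacent vertices in different
  blocks. By \<open>run_consistent\<close>, such a partition has the same run up to this
  time.\<close>

lemma consistent_colour_classes:
  assumes "wf_graph S G" "\<And>v w. {v, w} \<in> edges G \<Longrightarrow> c v \<noteq> c w"
  shows "consistent (colour_classes c (verts G)) G"
  unfolding consistent_def
proof (intro conjI ballI allI impI notI)
  show "\<exists>B\<in>colour_classes c (verts G). v \<subseteq> B" if "v \<in> verts G" for v
    using that unfolding colour_classes_def by blast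
next
  fix v w B assume e: "{v, w} \<in> edges G" and B: "B \<in> colour_classes c (verts G)" "v \<subseteq> B \<and> w \<subseteq> B"
  obtain k where k: "B = \<Union>{u \<in> verts G. c u = k}" using B(1) unfolding colour_classes_def by blast
  have "c u = k" if u: "u \<in> verts G" "u \<subseteq> B" for u
  proof -
    obtain a where "a \<in> u" using vert_nonempty[OF assms(1) u(1)] by blast
    then show ?thesis using mem_colour_class[OF wf_graph_partition[OF assms(1)] u(1), of a c k] u(2) k by blast
  qed
  then show False using assms(2)[OF e] B(2) wf_graph_edge[OF assms(1) e] by metis
qed

context active_clustering
begin

section \<open>Forced queries and chordality\<close>

text \<open>The walk is shortest only among walks inside the two blocks, yet it is induced in the
  whole graph: \<open>R\<close> contains every edge between vertices inside these blocks.\<close>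

lemma forced_induced_path:
  assumes P: "partition_on S P" and fo: "forced P t"
  obtains p where "induced_path (graph P t) p" "4 \<le> length p"
    "p ! 0 = vertex_of (graph P t) (fst (query P t))"
    "p ! (length p - 1) = vertex_of (graph P t) (snd (query P t))"
proof -
  define G where "G = graph P t"
  define q where "q = query P t"
  obtain B B' where B: "B \<in> P" "B' \<in> P" "fst q \<in> B" "snd q \<in> B'"
    and lk: "linked (hist P t) (B \<union> B') (fst q) (snd q)"
    and act: "active P t" and ans: "\<not> oracle_answer P q"
    using fo unfolding forced_def q_def by blast
  have wf: "wf_graph S G" and con: "consistent P G" and rec: "recorded S (hist P t) G"
    using wf_graph[OF P] consistent_graph[OF P] recorded_graph[OF P] by (simp_all add: G_def)
  note adm = admissible_queryD[OF wf_graph[OF P] admissible[OF P act], folded G_def q_def]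
  define x where "x = vertex_of G (fst q)"
  define y where "y = vertex_of G (snd q)"
  have xy: "fst q \<in> x" "snd q \<in> y" using vertex_of_mem(2)[OF wf] adm by (auto simp: x_def y_def)
  define R where "R = {(v, w). {v, w} \<in> edges G \<and> v \<subseteq> B \<union> B' \<and> w \<subseteq> B \<union> B'}"
  \<comment> \<open>The items whose vertex can be reached from \<open>x\<close> inside the two
    blocks. No earlier query inside them leaves this set, so \<open>linked_closed\<close>
    applies.\<close>
  define X where "X = {a. (x, vertex_of G a) \<in> R\<^sup>*}"
  have "fst q \<in> X \<longleftrightarrow> snd q \<in> X"
  proof (rule linked_closed[OF _ lk])
    fix a b r assume ab: "((a, b), r) \<in> set (hist P t)" "a \<in> B \<union> B'" "b \<in> B \<union> B'"
    have r: "a \<in> S" "b \<in> S" "if r then vertex_of G a = vertex_of G b else {vertex_of G a, vertex_of G b} \<in> edges G"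
      using rec ab(1) unfolding recorded_def by blast+
    have sub: "vertex_of G c \<subseteq> B \<union> B'" if "c \<in> S" "c \<in> B \<union> B'" for c
      using consistent_block[OF P con vertex_of_mem(1)[OF wf that(1)] _ vertex_of_mem(2)[OF wf that(1)]] that(2) B(1,2)
      by blast
    show "a \<in> X \<longleftrightarrow> b \<in> X"
    proof (cases r)
      case False
      then have "(vertex_of G a, vertex_of G b) \<in> R" "(vertex_of G b, vertex_of G a) \<in> R"
        using r sub ab(2,3) unfolding R_def by (auto simp: insert_commute)
      then show ?thesis unfolding X_def mem_Collect_eq by (meson rtrancl.rtrancl_into_rtrancl)
    qed (use r in \<open>simp add: X_def\<close>)
  qed
  then have xyR: "(x, y) \<in> R\<^sup>*" by (simp add: X_def x_def y_def)
  obtain f n where f01: "f 0 = x" "f n = y" and fs: "\<forall>i<n. (f i, f (Suc i)) \<in> R"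
      and chord: "\<forall>j\<le>n. \<forall>i<j. f i \<noteq> f j \<and> ((f i, f j) \<in> R \<longrightarrow> j = Suc i)"
    using shortest_walk[OF xyR] .
  note f = f01 fs[rule_format]
  have "x \<noteq> y" using adm by (simp add: x_def y_def)
  then have "n \<noteq> 0" using f by metis
  have fR: "f i \<in> verts G \<and> f i \<subseteq> B \<union> B'" if "i \<le> n" for i
  proof (cases "i < n")
    case True
    then show ?thesis using f(3)[of i] wf_graph_edge[OF wf] unfolding R_def by blast
  next
    case False
    then have "i = Suc (n - 1)" "n - 1 < n" using that \<open>n \<noteq> 0\<close> by auto
    then show ?thesis using f(3)[of "n - 1"] wf_graph_edge[OF wf] unfolding R_def by auto
  qed
  have side: "v \<subseteq> B \<or> v \<subseteq> B'" if v: "v \<in> verts G" "v \<subseteq> B \<union> B'" for v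
  proof -
    obtain a where "a \<in> v" using vert_nonempty[OF wf v(1)] by blast
    then show ?thesis
      using consistent_block[OF P con v(1) B(1), of a] consistent_block[OF P con v(1) B(2), of a] v(2) by blast
  qed
  have sqB: "snd q \<notin> B" using ans oracle_answer_iff[OF P B(1,3), of "snd q"] by simp
  have xB: "x \<subseteq> B" using consistent_block[OF P con _ B(1) xy(1) B(3)] adm by (simp add: x_def)
  have dis: "\<not> v \<subseteq> B'" if "v \<in> verts G" "v \<subseteq> B" for v
    using that vert_nonempty[OF wf] partition_on_unique[OF P B(1,2)] sqB B(4) by blast
  have alt: "\<not> (v \<subseteq> B \<and> w \<subseteq> B)" "\<not> (v \<subseteq> B' \<and> w \<subseteq> B')" if "{v, w} \<in> edges G" for v w
    using con that B(1,2) unfolding consistent_def by blast+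
  \<comment> \<open>Adjacent vertices lie in different blocks, so the walk alternates between
    \<open>B\<close> and \<open>B'\<close>.\<close>
  have par: "f i \<subseteq> B \<longleftrightarrow> even i" if "i \<le> n" for i
    using that
  proof (induction i)
    case (Suc i)
    have "{f i, f (Suc i)} \<in> edges G" using f(3)[of i] Suc.prems by (auto simp: R_def)
    then show ?case
      using Suc alt[of "f i" "f (Suc i)"] side[of "f i"] side[of "f (Suc i)"] fR[of i] fR[of "Suc i"] dis[of "f i"]
      by auto
  qed (simp add: f(1) xB)
  have "odd n" using par[of n] f(2) xy(2) sqB by auto
  \<comment> \<open>A single step would make the queried vertices adjacent, which admissibility
    excludes. Being odd, \<open>n\<close> is then at least 3, which means four vertices.\<close>
  have "n \<noteq> 1" using f(1,2) f(3)[of 0] adm by (auto simp: R_def x_def y_def)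
  then have n3: "3 \<le> n" using \<open>odd n\<close> by (cases n rule: parity_cases) presburger+
  define p where "p = map f [0..<Suc n]"
  have len: "length p = Suc n" and nth: "\<And>i. i \<le> n \<Longrightarrow> p ! i = f i"
    by (auto simp: p_def simp del: upt_Suc)
  have "inj_on f {0..<Suc n}"
  proof (rule inj_onI)
    fix i j assume "i \<in> {0..<Suc n}" "j \<in> {0..<Suc n}" "f i = f j"
    then show "i = j" using chord[rule_format, of i j] chord[rule_format, of j i] by (cases i j rule: linorder_cases) auto
  qed
  then have "distinct p" by (simp add: p_def distinct_map del: upt_Suc)
  moreover have "set p \<subseteq> verts G" using fR by (auto simp: p_def simp del: upt_Suc)
  moreover have "{f i, f j} \<in> edges G \<longleftrightarrow> j = Suc i \<or> i = Suc j" if ij: "i \<le> n" "j \<le> n" for i j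
  proof
    assume e: "{f i, f j} \<in> edges G"
    then have "(f i, f j) \<in> R" "(f j, f i) \<in> R" using fR ij by (auto simp: R_def insert_commute)
    moreover have "i \<noteq> j" using wf_graph_edge(3)[OF wf e] by blast
    ultimately show "j = Suc i \<or> i = Suc j" using chord[rule_format, of i j] chord[rule_format, of j i] ij by (cases i j rule: linorder_cases) auto
  next
    assume "j = Suc i \<or> i = Suc j"
    then show "{f i, f j} \<in> edges G" using f(3)[of i] f(3)[of j] ij by (auto simp: R_def insert_commute)
  qed
  ultimately have "induced_path G p" unfolding induced_path_def len by (auto simp: nth)
  then show ?thesis
    using n3 f(1,2) len nth[of 0] nth[of n] by (intro that[of p]) (auto simp: G_def x_def y_def q_def)
qed

lemma not_forced_if_chordal:
  assumes "chordal_algorithm S A" and P: "partition_on S P"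
  shows "\<not> forced P t"
proof
  assume fo: "forced P t"
  then have act: "active P t" "\<not> answer P t" by (auto simp: forced_def)
  obtain p where p: "induced_path (graph P t) p" "4 \<le> length p"
    "p ! 0 = vertex_of (graph P t) (fst (query P t))"
    "p ! (length p - 1) = vertex_of (graph P t) (snd (query P t))"
    using forced_induced_path[OF P fo] .
  have "induced_cycle (graph P (Suc t)) p"
    using induced_cycle_close[OF p(1)] p(2) act unfolding p(3,4) by (simp add: graph_Suc update_graph_cases)
  then have "length p = 3" using assms(1) P unfolding chordal_algorithm_def chordal_def by blast
  then show False using p(2) by simp
qed

text \<open>Colour the path alternately, so that its vertices form two blocks of a consistent partition.\<close>

lemma ex_forced_if_bipartite_path:
  assumes P: "partition_on S P" and act: "active P t" and p: "induced_path (graph P t) p"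
    and ij: "i < length p" "j < length p" "even i \<noteq> even j"
    and x: "vertex_of (graph P t) (fst (query P t)) = p ! i"
    and y: "vertex_of (graph P t) (snd (query P t)) = p ! j"
  shows "\<exists>P'. partition_on S P' \<and> forced P' t"
proof -
  define G where "G = graph P t"
  define q where "q = query P t"
  note wf = wf_graph[OF P, of t, folded G_def]
  note adm = admissible_queryD[OF wf_graph[OF P] admissible[OF P act], folded G_def q_def]
  define X where "X = {p ! k | k. k < length p \<and> even k}"
  define Y where "Y = {p ! k | k. k < length p \<and> odd k}"
  \<comment> \<open>The path vertices receive the two colours \<open>Inl True\<close> and
    \<open>Inl False\<close> by parity; every other vertex keeps a private colour
    \<open>Inr v\<close> and so becomes a block of its own.\<close>
  define c where "c v = (if v \<in> X then Inl True else if v \<in> Y then Inl False else Inr v)" for v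
  have pe: "{p ! k, p ! l} \<in> edges G \<longleftrightarrow> l = Suc k \<or> k = Suc l" if "k < length p" "l < length p" for k l
    using p that unfolding induced_path_def G_def by blast
  have cp: "c (p ! k) = Inl (even k)" if "k < length p" for k
    using p that nth_eq_iff_index_eq[of p] unfolding c_def X_def Y_def induced_path_def by auto
  have inv: "\<exists>k<length p. v = p ! k \<and> b = even k" if "c v = Inl b" for v b
    using that unfolding c_def X_def Y_def by (auto split: if_splits)
  have proper: "c v \<noteq> c w" if e: "{v, w} \<in> edges G" for v w
  proof
    assume eq: "c v = c w"
    have ne: "v \<noteq> w" using wf_graph_edge[OF wf e] by blast
    then obtain b where "c v = Inl b" "c w = Inl b"
      using eq unfolding c_def by (auto split: if_splits)
    then obtain k l where "k < length p" "v = p ! k" "b = even k" "l < length p" "w = p ! l" "b = even l"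
      using inv by metis
    then show False using e pe[of k l] by auto
  qed
  define P' where "P' = colour_classes c (verts G)"
  have P': "partition_on S P'"
    unfolding P'_def by (rule partition_on_colour_classes[OF wf_graph_partition[OF wf]])
  have con: "consistent P' G" unfolding P'_def by (rule consistent_colour_classes[OF wf proper])
  have run: "run S A P' t = run S A P t" using run_consistent[OF P P'] con by (simp add: G_def)
  have qG: "query P' t = q" "graph P' t = G" by (simp_all add: q_def G_def next_query_def aggregated_graph_def run)
  define B where "B b = \<Union>{w \<in> verts G. c w = Inl b}" for b
  have vp: "p ! k \<in> verts G" if "k < length p" for k using p that unfolding induced_path_def G_def by auto
  have xv: "fst q \<in> p ! i" "snd q \<in> p ! j"
    using vertex_of_mem(2)[OF wf adm(1)] vertex_of_mem(2)[OF wf adm(2)] x y by (simp_all add: G_def q_def)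
  have mem: "p ! k \<subseteq> B (even k)" if "k < length p" for k
    using vp[OF that] cp[OF that] unfolding B_def by blast
  have BP: "B (even k) \<in> P'" if "k < length p" for k
    unfolding P'_def colour_classes_def B_def using vp[OF that] cp[OF that] by force
  have "snd q \<notin> B (even i)"
    using mem_colour_class[OF wf_graph_partition[OF wf] vp[OF ij(2)] xv(2), of c "Inl (even i)"] cp[OF ij(2)] ij(3)
    unfolding B_def by simp
  then have ans: "\<not> oracle_answer P' q"
    using oracle_answer_iff[OF P' BP[OF ij(1)], of "fst q" "snd q"] mem[OF ij(1)] xv(1) by auto
  let ?U = "B (even i) \<union> B (even j)"
  have U: "p ! k \<subseteq> ?U" if "k < length p" for k
    using mem[OF that] ij(3) by (cases "even k = even i") auto
  \<comment> \<open>The whole path lies inside the two coloured blocks, so walking along it links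
    all of its items to those of its first vertex.\<close>
  have lk0: "linked (hist P' t) ?U a b" if "k < length p" "a \<in> p ! 0" "b \<in> p ! k" for a b k
    using that
  proof (induction k arbitrary: b)
    case 0
    then show ?case using linked_vertex[OF P' _ U, of 0 t a b] vp[of 0] by (simp add: qG)
  next
    case (Suc k)
    have kl: "k < length p" using Suc.prems(1) by simp
    obtain d where d: "d \<in> p ! k" using vert_nonempty[OF wf vp[OF kl]] by blast
    have "{p ! k, p ! Suc k} \<in> edges (graph P' t)" using pe[OF kl Suc.prems(1)] by (simp add: qG)
    then have "linked (hist P' t) ?U d b" using linked_edge[OF P' _ U[OF kl] U[OF Suc.prems(1)] d Suc.prems(3)] by blast
    then show ?case using linked_trans[OF Suc.IH[OF kl Suc.prems(2) d]] by blast
  qed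
  have "0 < length p" using ij(1) by auto
  then obtain a where a: "a \<in> p ! 0" using vert_nonempty[OF wf vp] by blast
  have "linked (hist P' t) ?U (fst q) (snd q)"
    using linked_trans[OF linked_sym[OF lk0[OF ij(1) a xv(1)]] lk0[OF ij(2) a xv(2)]] .
  moreover have "fst q \<in> B (even i)" "snd q \<in> B (even j)" using mem ij xv by blast+
  ultimately have "forced P' t"
    using BP[OF ij(1)] BP[OF ij(2)] ans act unfolding forced_def qG by (auto simp: G_def)
  then show ?thesis using P' by blast
qed


section \<open>Answering no from some time on\<close>

text \<open>Taking the current vertices themselves as the blocks keeps the run so far and makes
  every later answer negative.\<close>

lemma verts_as_partition:
  assumes P: "partition_on S P"
  shows "partition_on S (verts (graph P t))" "run S A (verts (graph P t)) t = run S A P t"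
proof -
  note wf = wf_graph[OF P, of t]
  show pV: "partition_on S (verts (graph P t))" by (rule wf_graph_partition[OF wf])
  have "consistent (verts (graph P t)) (graph P t)"
    using vert_eq_if_subset[OF wf] wf_graph_edge[OF wf] unfolding consistent_def by blast
  then show "run S A (verts (graph P t)) t = run S A P t" by (rule run_consistent[OF P pV])
qed

lemma discrete_answer:
  assumes V: "partition_on S V" and "verts (graph V s) = V" "active V s"
  shows "\<not> answer V s"
proof -
  note wf = wf_graph[OF V, of s]
  note adm = admissible_queryD[OF wf admissible[OF V assms(3)]]
  let ?x = "vertex_of (graph V s) (fst (query V s))"
  have "snd (query V s) \<notin> ?x" using vertex_of_eq[OF wf adm(3)] adm(5) by metis
  then show ?thesis
    using oracle_answer_iff[OF V, of ?x "fst (query V s)" "snd (query V s)"] adm(3) vertex_of_mem(2)[OF wf adm(1)] assms(2)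
    by simp
qed

text \<open>Answer no until a chord of the cycle is queried: it closes an even cycle of length at least 4
  together with one of the two arcs.\<close>

lemma ex_forced_if_odd_cycle:
  assumes P: "partition_on S P" and c: "induced_cycle (graph P t) c" and odd: "odd (length c)" "5 \<le> length c"
  shows "\<exists>P' s. partition_on S P' \<and> forced P' s"
proof -
  define V where "V = verts (graph P t)"
  have V: "partition_on S V" and run: "run S A V t = run S A P t"
    using verts_as_partition[OF P] by (simp_all add: V_def)
  have gt: "graph V t = graph P t" using run by (simp add: aggregated_graph_def)
  have vs: "verts (graph V s) = V" if "t \<le> s" for s
    using that
  proof (induction s rule: dec_induct)
    case base
    show ?case unfolding gt by (simp only: V_def)
  next
    case (step s)
    then show ?case using discrete_answer[OF V step(3)] by (simp add: graph_Suc update_graph_cases)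
  qed
  \<comment> \<open>The vertices stay fixed from time \<open>t\<close> on, but the final graph is
    complete; hence some query must destroy the induced cycle, and it does so by adding a
    chord.\<close>
  have "\<exists>s\<ge>t. induced_cycle (graph V s) c \<and> \<not> induced_cycle (graph V (Suc s)) c"
  proof (rule ccontr)
    assume no: "\<not> ?thesis"
    have ind: "induced_cycle (graph V s) c" if "t \<le> s" for s
      using that
    proof (induction s rule: dec_induct)
      case base
      then show ?case using c gt by simp
    qed (use no in blast)
    define s where "s = t + card S * card S"
    have cs: "complete_graph (graph V s)" using complete_at[OF V, of s] by (simp add: s_def)
    have cyc: "induced_cycle (graph V s) c" using ind by (simp add: s_def)
    have ds: "distinct c" "set c \<subseteq> verts (graph V s)" using cyc unfolding induced_cycle_def by blast+
    \<comment> \<open>Positions 0 and 2 are not neighbours on a cycle of length at least 5.\<close>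
    have l: "0 < length c" "2 < length c" using odd(2) by auto
    have "c ! 0 \<noteq> c ! 2" using nth_eq_iff_index_eq[OF ds(1) l] by simp
    moreover have "c ! 0 \<in> verts (graph V s)" "c ! 2 \<in> verts (graph V s)"
      using l ds(2) by (meson nth_mem subsetD)+
    ultimately have "{c ! 0, c ! 2} \<in> edges (graph V s)" using cs unfolding complete_graph_def by blast
    then have "2 = Suc 0 mod length c \<or> 0 = Suc 2 mod length c"
      using induced_cycle_edge_iff[OF cyc l] by blast
    then show False using odd(2) by (auto simp: mod_Suc)
  qed
  then obtain s where s: "t \<le> s" "induced_cycle (graph V s) c" "\<not> induced_cycle (graph V (Suc s)) c" by blast
  then have act: "active V s" by (auto simp: graph_Suc)
  define G where "G = graph V s"
  define x where "x = vertex_of G (fst (query V s))"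
  define y where "y = vertex_of G (snd (query V s))"
  have gS: "graph V (Suc s) = add_edge x y G"
    using act discrete_answer[OF V vs[OF s(1)] act] by (simp add: graph_Suc update_graph_cases x_def y_def G_def)
  note adm = admissible_queryD[OF wf_graph[OF V] admissible[OF V act], folded G_def, folded x_def y_def]
  have xy: "x \<in> set c" "y \<in> set c" using induced_cycle_add_edgeD[of x y G c] s gS by (auto simp: G_def)
  obtain k where k: "rotate k c \<noteq> []" "rotate k c ! 0 = x" using rotate_to_front[OF xy(1)] .
  define d where "d = rotate k c"
  let ?n = "length d"
  have n: "odd ?n" "5 \<le> ?n" using odd by (simp_all add: d_def)
  have d: "induced_cycle G d" using induced_cycle_rotate[OF s(2)] by (simp add: d_def G_def)
  have d0: "d ! 0 = x" using k by (simp add: d_def)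
  obtain m where m: "m < ?n" "d ! m = y" using xy(2) by (metis d_def in_set_conv_nth set_rotate)
  have "0 < ?n" using n by auto
  then have "\<not> (m = Suc 0 mod ?n \<or> 0 = Suc m mod ?n)"
    using induced_cycle_edge_iff[OF d, of 0 m] m d0 adm(6) by metis
  moreover have "m \<noteq> 0" using m d0 adm(5) by metis
  ultimately have m2: "2 \<le> m" "m < ?n - 1" using m(1) n by (auto simp: mod_Suc split: if_splits)
  \<comment> \<open>The colouring argument works for any two positions of opposite parity on an
    induced path, not only for its ends; the path is the cycle without its last vertex.\<close>
  have forced: "\<exists>P'. partition_on S P' \<and> forced P' s"
    if "induced_cycle G e" "i < length e - 1" "j < length e - 1" "even i \<noteq> even j" "e ! i = x" "e ! j = y" for e i j
    using ex_forced_if_bipartite_path[OF V act, of "butlast e" i j] induced_path_butlast[OF that(1)] that(2-6)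
    by (simp add: nth_butlast G_def x_def y_def)
  \<comment> \<open>As \<open>?n\<close> is odd, exactly one of the two arcs between
    \<open>x\<close> and \<open>y\<close> has odd length, and the vertex dropped by
    \<open>butlast\<close> must lie inside the other one. For odd \<open>m\<close> the last vertex
    does; for even \<open>m\<close> it is \<open>d ! 1\<close>, which rotating by 2 brings to the
    end.\<close>
  show ?thesis
  proof (cases "odd m")
    case True
    then show ?thesis using forced[OF d, of 0 m] d0 m m2 by auto
  next
    case False
    define e where "e = rotate 2 d"
    have "2 + (?n - 2) = ?n" "2 + (m - 2) = m" using n m2 by auto
    then have "e ! (?n - 2) = x"
      using n d0 nth_rotate[of "?n - 2" d 2, unfolded \<open>2 + (?n - 2) = ?n\<close>] by (simp add: e_def)
    moreover have "e ! (m - 2) = y"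
      using n m m2 nth_rotate[of "m - 2" d 2, unfolded \<open>2 + (m - 2) = m\<close>] by (simp add: e_def)
    moreover have "even (?n - 2) \<noteq> even (m - 2)" using n m2 False by simp
    moreover have "?n - 2 < length e - 1" "m - 2 < length e - 1" using n m2 by (simp_all add: e_def)
    moreover have "induced_cycle G e" using induced_cycle_rotate[OF d] by (simp add: e_def)
    ultimately show ?thesis using forced[of e "?n - 2" "m - 2"] by blast
  qed
qed

lemma ex_forced_if_query_joins_path:
  assumes P: "partition_on S P" and act: "active P t" and p: "induced_path (graph P t) p" and len: "4 \<le> length p"
    and ends: "{p ! 0, p ! (length p - 1)} =
      {vertex_of (graph P t) (fst (query P t)), vertex_of (graph P t) (snd (query P t))}"
  shows "\<exists>P' s. partition_on S P' \<and> forced P' s"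
proof (cases "even (length p)")
  case True
  have pos: "0 < length p" "length p - 1 < length p" "even (0::nat) \<noteq> even (length p - 1)"
    using len True by auto
  show ?thesis
    using ends unfolding doubleton_eq_iff
  proof
    assume "p ! 0 = vertex_of (graph P t) (fst (query P t)) \<and>
      p ! (length p - 1) = vertex_of (graph P t) (snd (query P t))"
    then show ?thesis using ex_forced_if_bipartite_path[OF P act p pos] by metis
  next
    assume "p ! 0 = vertex_of (graph P t) (snd (query P t)) \<and>
      p ! (length p - 1) = vertex_of (graph P t) (fst (query P t))"
    then show ?thesis
      using ex_forced_if_bipartite_path[OF P act p pos(2,1) pos(3)[symmetric]] by metis
  qed
next
  case False
  \<comment> \<open>Only a negative answer closes the path to a cycle, so the run is continued on
    the partition into the current vertices.\<close>
  define V where "V = verts (graph P t)"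
  have V: "partition_on S V" and run: "run S A V t = run S A P t"
    using verts_as_partition[OF P] by (simp_all add: V_def)
  have same: "graph V t = graph P t" "query V t = query P t"
    using run by (simp_all add: aggregated_graph_def next_query_def)
  have actV: "active V t" using act same by simp
  have "verts (graph V t) = V" unfolding same(1) by (simp only: V_def)
  then have "\<not> answer V t" using discrete_answer[OF V _ actV] by blast
  then have "graph V (Suc t) = add_edge (vertex_of (graph P t) (fst (query P t)))
      (vertex_of (graph P t) (snd (query P t))) (graph P t)"
    using actV by (simp add: graph_Suc update_graph_cases same)
  also have "\<dots> = add_edge (p ! 0) (p ! (length p - 1)) (graph P t)"
    unfolding add_edge_def ends ..
  finally have "induced_cycle (graph V (Suc t)) p" using induced_cycle_close[OF p] len by simp
  moreover have "5 \<le> length p" using len False by (cases "length p = 4") auto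
  ultimately show ?thesis using ex_forced_if_odd_cycle[OF V] False by blast
qed

text \<open>Forced queries have to be excluded for all partitions and times, since the one extracted
  from a non-chordal graph may belong to another partition and a later time.\<close>

lemma chordal_if_not_forced:
  assumes nf: "\<And>P t. partition_on S P \<Longrightarrow> \<not> forced P t"
  shows "chordal_algorithm S A"
  unfolding chordal_algorithm_def
proof (intro allI impI)
  fix P t assume P: "partition_on S P"
  show "chordal (graph P t)"
  proof (induction t)
    case 0
    have "\<not> induced_cycle (initial_graph S) c" for c
    proof
      assume c: "induced_cycle (initial_graph S) c"
      then have "3 \<le> length c" by (simp add: induced_cycle_def)
      then have "{c ! 0, c ! 1} \<in> edges (initial_graph S)"
        by (subst induced_cycle_edge_iff[OF c]) auto
      then show False by (simp add: initial_graph_def)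
    qed
    then show ?case by (simp add: graph_0 chordal_def)
  next
    case (Suc t)
    show ?case
    proof (cases "active P t")
      case False
      then show ?thesis using Suc by (simp add: graph_Suc)
    next
      case act: True
      define G where "G = graph P t"
      define x where "x = vertex_of G (fst (query P t))"
      define y where "y = vertex_of G (snd (query P t))"
      have wf: "wf_graph S G" using wf_graph[OF P] by (simp add: G_def)
      note adm = admissible_queryD[OF wf_graph[OF P] admissible[OF P act], folded G_def, folded x_def y_def]
      have no_path: False if "induced_path G p" "4 \<le> length p" "{p ! 0, p ! (length p - 1)} = {x, y}" for p
        using ex_forced_if_query_joins_path[OF P act, of p] that nf by (auto simp: G_def x_def y_def)
      have gS: "graph P (Suc t) = (if answer P t then merge x y G else add_edge x y G)"
        using act by (simp add: graph_Suc update_graph_cases G_def x_def y_def)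
      show ?thesis
        unfolding chordal_def
      proof (intro allI impI, rule ccontr)
        fix c assume c: "induced_cycle (graph P (Suc t)) c" and l: "length c \<noteq> 3"
        show False
        proof (cases "answer P t")
          case True
          then have "induced_cycle (merge x y G) c" using c gS by simp
          then obtain p where "induced_path G p" "5 \<le> length p" "{p ! 0, p ! (length p - 1)} = {x, y}"
            using induced_path_if_merged_cycle[OF wf adm(3-6) _ _ l] Suc unfolding G_def by blast
          then show False using no_path[of p] by simp
        next
          case False
          then have "induced_cycle (add_edge x y G) c" using c gS by simp
          moreover have "\<not> induced_cycle G c" using Suc l unfolding G_def chordal_def by blast
          ultimately obtain p where "induced_path G p" "length p = length c" "{p ! 0, p ! (length p - 1)} = {x, y}"
            using induced_path_if_new_cycle[OF _ _ adm(6,5)] by blast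
          moreover have "4 \<le> length c" using c l by (auto simp: induced_cycle_def)
          ultimately show False using no_path[of p] by simp
        qed
      qed
    qed
  qed
qed


text \<open>On the induced path given by a forced query, the second vertex is a neighbour of the
  first but not of the last. Domination forbids exactly this, so it is a local test for unforced
  queries.\<close>

lemma not_forced_if_dominated:
  assumes P: "partition_on S P"
    and dom: "\<And>w. {vertex_of (graph P t) (fst (query P t)), w} \<in> edges (graph P t) \<Longrightarrow>
      {vertex_of (graph P t) (snd (query P t)), w} \<in> edges (graph P t)"
  shows "\<not> forced P t"
proof
  assume "forced P t"
  then obtain p where p: "induced_path (graph P t) p" "4 \<le> length p"
    "p ! 0 = vertex_of (graph P t) (fst (query P t))"
    "p ! (length p - 1) = vertex_of (graph P t) (snd (query P t))"
    using forced_induced_path[OF P] by blast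
  have e: "{p ! i, p ! j} \<in> edges (graph P t) \<longleftrightarrow> j = Suc i \<or> i = Suc j" if "i < length p" "j < length p" for i j
    using p(1) that unfolding induced_path_def by blast
  have "0 < length p" "1 < length p" using p(2) by auto
  then have "{p ! (length p - 1), p ! 1} \<in> edges (graph P t)"
    using dom[of "p ! 1"] e[of 0 1] p(3,4) by auto
  moreover have "length p - 1 < length p" "1 < length p" using p(2) by auto
  ultimately show False using e[of "length p - 1" 1] p(2) by auto
qed

definition forced_count :: nat where
  "forced_count = (\<Sum>P | partition_on S P. \<Sum>t<card S * card S. of_bool (forced P t))"

lemma forced_count_eq_0_iff: "forced_count = 0 \<longleftrightarrow> (\<forall>P t. partition_on S P \<longrightarrow> \<not> forced P t)"
proof -
  have "t < card S * card S" if "partition_on S P" "forced P t" for P t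
    using complete_at[OF that(1), of t] that(2) by (auto simp: forced_def not_le[symmetric])
  then show ?thesis
    using finitely_many_partition_on[OF finite_S] unfolding forced_count_def by auto
qed

lemma chordal_iff_forced_count: "chordal_algorithm S A \<longleftrightarrow> forced_count = 0"
  using not_forced_if_chordal chordal_if_not_forced unfolding forced_count_eq_0_iff by blast

end

section \<open>An algorithm without forced queries\<close>

text \<open>An algorithm receives only the history, while the strategy below is described by the
  graph, which is therefore rebuilt. Histories list the latest query first, so \<open>foldr\<close>
  applies the oldest one first.\<close>

definition replay :: "'a set \<Rightarrow> 'a history \<Rightarrow> 'a set graph" where
  "replay S h = foldr (\<lambda>(q, r). update_graph q r) h (initial_graph S)"

lemma replay_run: "replay S (fst (run S A P t)) = snd (run S A P t)"
  by (induction t) (auto simp: replay_def Let_def case_prod_unfold)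

text \<open>Items are inserted one at a time into a clique; \<open>v\<close> is the vertex being inserted.\<close>

definition near_clique :: "'a set graph \<Rightarrow> bool" where
  "near_clique G \<longleftrightarrow> (\<exists>K v. K \<subseteq> verts G \<and> v \<in> verts G \<and>
     (\<forall>x\<in>K. \<forall>y\<in>K. x \<noteq> y \<longrightarrow> {x, y} \<in> edges G) \<and> (\<forall>e\<in>edges G. e \<subseteq> insert v K))"

text \<open>The shape must survive either answer, because the answer is not known in advance. The
  last conjunct is the domination condition that rules out forced queries.\<close>

definition good_query :: "'a set \<Rightarrow> 'a set graph \<Rightarrow> 'a \<times> 'a \<Rightarrow> bool" where
  "good_query S G q \<longleftrightarrow> admissible_query S G q \<and> (\<forall>r. near_clique (update_graph q r G)) \<and>
     (\<forall>w. {vertex_of G (fst q), w} \<in> edges G \<longrightarrow> {vertex_of G (snd q), w} \<in> edges G)"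

text \<open>The vertex being inserted is compared with a clique vertex not yet adjacent to it. Its
  neighbours belong to the clique, so the clique vertex dominates it.\<close>

lemma ex_good_query:
  assumes wf: "wf_graph S G" and "near_clique G" "\<not> complete_graph G"
  shows "\<exists>q. good_query S G q"
proof -
  obtain K0 v0 where *: "K0 \<subseteq> verts G \<and> v0 \<in> verts G \<and>
     (\<forall>x\<in>K0. \<forall>y\<in>K0. x \<noteq> y \<longrightarrow> {x, y} \<in> edges G) \<and> (\<forall>e\<in>edges G. e \<subseteq> insert v0 K0)"
    using assms(2) unfolding near_clique_def by (elim exE)
  then have K0: "K0 \<subseteq> verts G" "v0 \<in> verts G" "\<And>e. e \<in> edges G \<Longrightarrow> e \<subseteq> insert v0 K0"
      "\<And>x y. x \<in> K0 \<Longrightarrow> y \<in> K0 \<Longrightarrow> x \<noteq> y \<Longrightarrow> {x, y} \<in> edges G"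
    by auto
  \<comment> \<open>If \<open>v0\<close> is already adjacent to all other vertices of
    \<open>K0\<close>, it joins the clique and a vertex outside becomes the next one to
    insert.\<close>
  obtain K v k where K: "K \<subseteq> verts G" "v \<in> verts G" "v \<notin> K" "k \<in> K" "{v, k} \<notin> edges G"
      "\<And>x y. x \<in> K \<Longrightarrow> y \<in> K \<Longrightarrow> x \<noteq> y \<Longrightarrow> {x, y} \<in> edges G" "\<And>e. e \<in> edges G \<Longrightarrow> e \<subseteq> insert v K"
  proof (cases "\<exists>k\<in>K0. k \<noteq> v0 \<and> {v0, k} \<notin> edges G")
    case True
    then obtain k where "k \<in> K0" "k \<noteq> v0" "{v0, k} \<notin> edges G" by auto
    show ?thesis
    proof (rule that[of "K0 - {v0}" v0 k])
      show "e \<subseteq> insert v0 (K0 - {v0})" if "e \<in> edges G" for e using K0(3)[OF that] by auto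
    qed (use K0(1,2,4) \<open>k \<in> K0\<close> \<open>k \<noteq> v0\<close> \<open>{v0, k} \<notin> edges G\<close> in auto)
  next
    case False
    define K1 where "K1 = insert v0 K0"
    have c: "{x, y} \<in> edges G" if "x \<in> K1" "y \<in> K1" "x \<noteq> y" for x y
      using that K0(4) False unfolding K1_def by (auto simp: insert_commute)
    have sub: "K1 \<subseteq> verts G" using K0 by (auto simp: K1_def)
    then obtain v where v: "v \<in> verts G" "v \<notin> K1"
      using c assms(3) unfolding complete_graph_def by blast
    have e: "e \<subseteq> K1" if "e \<in> edges G" for e using K0(3)[OF that] by (simp add: K1_def)
    show ?thesis
    proof (rule that[of K1 v v0])
      show "{v, v0} \<notin> edges G" using e[of "{v, v0}"] v by auto
      show "e \<subseteq> insert v K1" if "e \<in> edges G" for e using e[OF that] by auto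
      show "v0 \<in> K1" by (simp add: K1_def)
    qed (use sub v c in auto)
  qed
  have kv: "k \<in> verts G" "v \<noteq> k" using K by auto
  obtain a b where ab: "a \<in> v" "b \<in> k"
    using vert_nonempty[OF wf K(2)] vert_nonempty[OF wf kv(1)] by blast
  have va: "vertex_of G a = v" "vertex_of G b = k"
    using vertex_of_eq[OF wf] K(2) kv(1) ab by auto
  have ads: "a \<in> S" "b \<in> S" using vert_subset[OF wf] K(2) kv(1) ab by auto
  have nb: "w \<in> K \<and> w \<noteq> k \<and> {k, w} \<in> edges G" if "{v, w} \<in> edges G" for w
  proof -
    have "w \<noteq> v" using wf_graph_edge(3)[OF wf that] by blast
    moreover have "w \<in> insert v K" using K(7)[OF that] by blast
    moreover have "w \<noteq> k" using that K(5) by blast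
    ultimately show ?thesis using K(4,6) by blast
  qed
  have "near_clique (add_edge v k G)"
    unfolding near_clique_def
  proof (intro exI[of _ K] exI[of _ v] conjI ballI impI)
    show "e \<subseteq> insert v K" if "e \<in> edges (add_edge v k G)" for e
      using that K(4,7) by auto
  qed (use K in auto)
  moreover have "near_clique (merge v k G)"
  proof -
    note mold = edges_merge_old[OF wf K(2) kv(1) kv(2) K(5)] and mnew = edges_merge_new[OF wf K(2) kv(1) kv(2) K(5)]
    \<comment> \<open>The merged vertex takes the place of \<open>k\<close> in the clique and also
      serves as the vertex being inserted, since the insertion is finished.\<close>
    let ?K = "insert (v \<union> k) (K - {k})"
    have new: "{v \<union> k, w} \<in> edges (merge v k G)" if "w \<in> K - {k}" for w
    proof -
      have "{k, w} \<in> edges G" using K(4,6) that by blast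
      moreover have "w \<in> verts G" using K(1) that by blast
      ultimately show ?thesis using mnew by blast
    qed
    have sub: "?K \<subseteq> verts (merge v k G)" "v \<union> k \<in> verts (merge v k G)"
      using K(1,3) by (auto simp: verts_merge)
    have clique: "{x, y} \<in> edges (merge v k G)" if xy: "x \<in> ?K" "y \<in> ?K" "x \<noteq> y" for x y
    proof -
      consider "x = v \<union> k" "y \<in> K - {k}" | "y = v \<union> k" "x \<in> K - {k}" | "x \<in> K - {k}" "y \<in> K - {k}"
        using xy by blast
      then show ?thesis
      proof cases
        case 1
        then show ?thesis using new by blast
      next
        case 2
        then show ?thesis using new by (simp add: insert_commute)
      next
        case 3
        then show ?thesis using mold[of x y] K(1,3) K(6)[of x y] xy(3) by auto
      qed
    qed
    have edge: "e \<subseteq> insert (v \<union> k) ?K" if e: "e \<in> edges (merge v k G)" for e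
    proof (rule edges_mergeE[OF wf K(2) kv(1) kv(2) K(5) e])
      fix x y assume "e = {x, y}" "x \<notin> {v, k}" "y \<notin> {v, k}" "{x, y} \<in> edges G"
      then show "e \<subseteq> insert (v \<union> k) ?K" using K(7)[of "{x, y}"] by auto
    next
      fix w assume "e = {v \<union> k, w}" "w \<notin> {v, k}" "{v, w} \<in> edges G \<or> {k, w} \<in> edges G"
      then show "e \<subseteq> insert (v \<union> k) ?K" using K(7)[of "{v, w}"] K(7)[of "{k, w}"] by auto
    qed
    show ?thesis
      unfolding near_clique_def
      by (intro exI[of _ ?K] exI[of _ "v \<union> k"] conjI ballI impI)
        (rule sub, rule sub, rule clique, assumption+, rule edge, assumption)
  qed
  ultimately have "near_clique (update_graph (a, b) r G)" for r
    by (simp add: update_graph_cases va)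
  moreover have "admissible_query S G (a, b)"
    using ads va kv K(5) by (simp add: admissible_query_def)
  ultimately have "good_query S G (a, b)"
    using nb by (simp add: good_query_def va)
  then show ?thesis by blast
qed

definition clique_algorithm :: "'a set \<Rightarrow> 'a algorithm" where
  "clique_algorithm S h = (SOME q. good_query S (replay S h) q)"

lemma good_query_clique_algorithm:
  assumes "S \<noteq> {}" "\<not> complete_graph (aggregated_graph S (clique_algorithm S) P t)"
  shows "good_query S (aggregated_graph S (clique_algorithm S) P t) (next_query S (clique_algorithm S) P t)"
proof -
  let ?A = "clique_algorithm S"
  have good: "good_query S (snd (run S ?A P t)) (?A (fst (run S ?A P t)))"
    if "wf_graph S (snd (run S ?A P t)) \<and> near_clique (snd (run S ?A P t))"
      "\<not> complete_graph (snd (run S ?A P t))" for t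
    unfolding clique_algorithm_def replay_run
    using someI_ex[OF ex_good_query] that unfolding clique_algorithm_def by blast
  have inv: "wf_graph S (snd (run S ?A P t)) \<and> near_clique (snd (run S ?A P t))" for t
  proof (induction t)
    case 0
    \<comment> \<open>The clique may be empty, but \<open>near_clique\<close> asks for some vertex;
      this is where \<open>S \<noteq> {}\<close> enters.\<close>
    obtain s where "s \<in> S" using assms(1) by blast
    then have "near_clique (initial_graph S)"
      unfolding near_clique_def by (intro exI[of _ "{}"] exI[of _ "{s}"]) (simp add: initial_graph_def)
    then show ?case by (simp add: wf_initial_graph)
  next
    case (Suc t)
    show ?case
    proof (cases "complete_graph (snd (run S ?A P t))")
      case False
      then show ?thesis
        using good[OF Suc False] wf_update[OF conjunct1[OF Suc]] unfolding good_query_def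
        by (simp add: Let_def case_prod_unfold)
    qed (use Suc in \<open>simp add: Let_def case_prod_unfold\<close>)
  qed
  show ?thesis using good inv assms(2) by (simp add: aggregated_graph_def next_query_def)
qed

lemma ex_forced_count_0:
  assumes "finite S" "S \<noteq> {}"
  shows "\<exists>B. AC_algorithm S B \<and> active_clustering.forced_count S B = 0"
proof -
  let ?B = "clique_algorithm S"
  note good = good_query_clique_algorithm[OF assms(2)]
  have AC: "AC_algorithm S ?B" unfolding AC_algorithm_def using good by (auto simp: good_query_def)
  interpret B: active_clustering S ?B by unfold_locales (fact assms AC)+
  have "\<not> B.forced P t" if P: "partition_on S P" for P t
  proof (cases "B.active P t")
    case True
    show ?thesis using good[OF True] by (intro B.not_forced_if_dominated[OF P]) (auto simp: good_query_def)
  qed (simp add: B.forced_def)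
  then show ?thesis using AC B.forced_count_eq_0_iff by blast
qed

section \<open>Comparison of average complexities\<close>

lemma average_complexity_eq:
  assumes "finite S"
  shows "average_complexity S A =
    real (\<Sum>P | partition_on S P. complexity S A P) / real (card {P. partition_on S P})"
  unfolding average_complexity_def
  using finitely_many_partition_on[OF assms] partition_on_singletons[of S]
  by (subst integral_pmf_of_set) auto

theorem theorem1:
  fixes S :: "'a set" and n :: nat and A :: "'a algorithm"
  assumes "n \<ge> 1"
    and "finite S" and "card S = n"
    and "AC_algorithm S A"
  shows "minimal_average_complexity S A \<longleftrightarrow> chordal_algorithm S A"
proof -
  interpret active_clustering S A by unfold_locales (fact assms)+
  let ?\<Pi> = "{P. partition_on S P}"
  have "S \<noteq> {}" using assms(1,3) by auto
  have pos: "0 < card ?\<Pi>"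
    using finitely_many_partition_on[OF finite_S] partition_on_singletons[of S] by (auto simp: card_gt_0_iff)
  \<comment> \<open>In \<open>sum_complexity\<close> the first two summands agree for
    \<open>A\<close> and \<open>B\<close>, and both averages have the same positive denominator, so
    only the numbers of forced queries matter.\<close>
  have le_iff: "average_complexity S A \<le> average_complexity S B \<longleftrightarrow> forced_count \<le> active_clustering.forced_count S B"
    if "AC_algorithm S B" for B
  proof -
    interpret B: active_clustering S B by unfold_locales (fact finite_S that)+
    have "average_complexity S A \<le> average_complexity S B \<longleftrightarrow>
        (\<Sum>P\<in>?\<Pi>. complexity S A P) \<le> (\<Sum>P\<in>?\<Pi>. complexity S B P)"
      unfolding average_complexity_eq[OF finite_S] using pos
      by (simp add: divide_le_cancel del: of_nat_sum)
    then show ?thesis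
      using sum_complexity B.sum_complexity unfolding forced_count_def B.forced_count_def by linarith
  qed
  \<comment> \<open>The value 0 is attained by the clique algorithm, so the minimum of the forced
    counts is 0.\<close>
  have "minimal_average_complexity S A \<longleftrightarrow> forced_count = 0"
  proof
    assume "minimal_average_complexity S A"
    moreover obtain B where "AC_algorithm S B" "active_clustering.forced_count S B = 0"
      using ex_forced_count_0[OF finite_S \<open>S \<noteq> {}\<close>] by blast
    ultimately show "forced_count = 0"
      using le_iff unfolding minimal_average_complexity_def by force
  qed (simp add: le_iff minimal_average_complexity_def)
  then show ?thesis by (simp add: chordal_iff_forced_count)
qed

end
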